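(* Let $(X,d,A)$ be a metric pair. A set $S\subset(\overline{D}_\infty(X,A),W_\infty)$ is relatively compact if and only if $S$ is uniformly upper finite and upper relatively compact. For $p\in[1,\infty)$, a set $S\subset(\overline{D}_p(X,A),W_p)$ is relatively compact if and only if $S$ is uniformly upper finite, upper relatively compact, and uniformly $p$-vanishing.
   Context: A metric on $X$ is a map $d:X\times X\to[0,\infty]$ with $d(x,x)=0$, symmetry and the triangle inequality (infinite distances allowed, $d(x,y)=0$ need not imply $x=y$); a metric pair $(X,d,A)$ is such a space with a closed subset $A$. Write $d(x,A)=\inf_{a\in A}d(x,a)$, $A^\delta=\{x:d(x,A)<\delta\}$ for $\delta\in(0,\infty]$. $\overline{D}(X,A)$ is the set of countable formal sums $\hat\alpha=\sum_{i\in I}x_i$ of points of $X\setminus A$ (repetitions allowed); $0$ the empty sum; $|\alpha|=|I|$; the support of $\alpha$ is the set of points appearing in $\hat\alpha$. A matching of $\hat\alpha=\sum_{i\in I}x_i$, $\hat\beta=\sum_{j\in J}y_j$ is a formal sum $\sum_{k\in K}(x_k,y_{\varphi(k)})+\sum_{i\in I\setminus K}(x_i,z_i)+\sum_{j\in J\setminus\varphi(K)}(w_j,y_j)$ with $K\subset I$, $\varphi$ injective, $z_i,w_j\in A$; its $p$-cost is the $\ell^p$ norm (sup norm if $p=\infty$) of the distances of paired points; $W_p$ is the infimum of $p$-costs. $u_\delta(\alpha)$, $\ell_\delta(\alpha)$ are the restrictions of $\hat\alpha$ to $X\setminus A^\delta$ and to $A^\delta\setminus A$. For $p<\infty$, $\overline{D}_p(X,A)=\{\alpha: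 |u_\infty(\alpha)|<\infty,\ W_p(\ell_\infty(\alpha),0)<\infty\}$; $\overline{D}_\infty(X,A)=\{\alpha:|u_\delta(\alpha)|<\infty\ \forall\delta>0\}$. A subset of a topological space is relatively compact if its closure is compact. For $S\subset\overline{D}(X,A)$: $S$ is uniformly upper finite if for every $\varepsilon>0$ there is $M_\varepsilon\ge0$ with $|u_\varepsilon(\alpha)|\le M_\varepsilon$ for all $\alpha\in S$; $S$ is upper relatively compact if for every $\varepsilon>0$ the set $u_\varepsilon(S)=\bigcup_{\alpha\in S}\mathrm{supp}(u_\varepsilon(\alpha))$ is relatively compact in $(X,d)$; $S$ is uniformly $p$-vanishing if for every $\varepsilon>0$ there is $\delta>0$ with $W_p(\ell_\delta(\alpha),0)<\varepsilon$ for all $\alpha\in S$. *)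

theory Defs
  imports "HOL-Analysis.Analysis"
begin

text \<open>A metric in the sense of the paper: values in [0,\<infinity>], d x x = 0,
  symmetry and triangle inequality (infinite distances and zero distances
  between distinct points allowed).  The underlying space X is the type 'a.\<close>

definition ext_metric :: "('a \<Rightarrow> 'a \<Rightarrow> ennreal) \<Rightarrow> bool" where
  "ext_metric d \<longleftrightarrow> (\<forall>x. d x x = 0) \<and> (\<forall>x y. d x y = d y x) \<and>
     (\<forall>x y z. d x z \<le> d x y + d y z)"

definition ball_open :: "'b set \<Rightarrow> ('b \<Rightarrow> 'b \<Rightarrow> ennreal) \<Rightarrow> 'b set \<Rightarrow> bool" where
  "ball_open D f U \<longleftrightarrow> U \<subseteq> D \<and> (\<forall>x\<in>U. \<exists>e>0. \<forall>y\<in>D. f x y < e \<longrightarrow> y \<in> U)"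

lemma istopology_ball_open: "istopology (ball_open D f)"
proof -
  have int: "ball_open D f (S \<inter> T)" if S: "ball_open D f S" and T: "ball_open D f T" for S T
  proof -
    have "\<exists>e>0. \<forall>y\<in>D. f x y < e \<longrightarrow> y \<in> S \<inter> T" if x: "x \<in> S \<inter> T" for x
    proof -
      obtain e1 where e1: "e1 > 0" "\<forall>y\<in>D. f x y < e1 \<longrightarrow> y \<in> S"
        using S x unfolding ball_open_def by blast
      obtain e2 where e2: "e2 > 0" "\<forall>y\<in>D. f x y < e2 \<longrightarrow> y \<in> T"
        using T x unfolding ball_open_def by blast
      have "min e1 e2 > 0" using e1 e2 by simp
      moreover have "\<forall>y\<in>D. f x y < min e1 e2 \<longrightarrow> y \<in> S \<inter> T"
        using e1(2) e2(2) by simp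
      ultimately show ?thesis by blast
    qed
    moreover have "S \<inter> T \<subseteq> D" using S unfolding ball_open_def by blast
    ultimately show ?thesis unfolding ball_open_def by blast
  qed
  have un: "ball_open D f (\<Union>K)" if H: "\<forall>U\<in>K. ball_open D f U" for K
  proof -
    have "\<Union>K \<subseteq> D" using H unfolding ball_open_def by auto
    moreover have "\<exists>e>0. \<forall>y\<in>D. f x y < e \<longrightarrow> y \<in> \<Union>K" if x: "x \<in> \<Union>K" for x
    proof -
      obtain U where U: "U \<in> K" "x \<in> U" using x by auto
      then have "ball_open D f U" using H by auto
      then obtain e where "e > 0" "\<forall>y\<in>D. f x y < e \<longrightarrow> y \<in> U"
        using U(2) unfolding ball_open_def by auto
      then show ?thesis using U(1) by auto
    qed
    ultimately show ?thesis unfolding ball_open_def by auto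
  qed
  show ?thesis unfolding istopology_def using int un by auto
qed

definition ball_topology :: "'b set \<Rightarrow> ('b \<Rightarrow> 'b \<Rightarrow> ennreal) \<Rightarrow> 'b topology" where
  "ball_topology D f = topology (ball_open D f)"

lemma openin_ball_topology: "openin (ball_topology D f) U \<longleftrightarrow> ball_open D f U"
  unfolding ball_topology_def by (simp add: istopology_ball_open)

definition rel_compact_in :: "'b topology \<Rightarrow> 'b set \<Rightarrow> bool" where
  "rel_compact_in T S \<longleftrightarrow> compactin T (T closure_of S)"

definition metric_pair :: "('a \<Rightarrow> 'a \<Rightarrow> ennreal) \<Rightarrow> 'a set \<Rightarrow> bool" where
  "metric_pair d A \<longleftrightarrow> ext_metric d \<and> closedin (ball_topology UNIV d) A"

definition dist_set :: "('a \<Rightarrow> 'a \<Rightarrow> ennreal) \<Rightarrow> 'a \<Rightarrow> 'a set \<Rightarrow> ennreal" where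
  "dist_set d x A = (INF a\<in>A. d x a)"

definition thick :: "('a \<Rightarrow> 'a \<Rightarrow> ennreal) \<Rightarrow> 'a set \<Rightarrow> ennreal \<Rightarrow> 'a set" where
  "thick d A \<delta> = {x. dist_set d x A < \<delta>}"

text \<open>A countable formal sum \<Sum>_{i\<in>I} x_i is represented by an index set
  I \<subseteq> nat (any countable index set can be reindexed into nat) together with
  the family x; only the values x i for i \<in> I matter.\<close>

type_synonym 'a dgm = "nat set \<times> (nat \<Rightarrow> 'a)"

definition Dbar :: "'a set \<Rightarrow> 'a dgm set" where
  "Dbar A = {(I, x). \<forall>i\<in>I. x i \<notin> A}"

definition zero_dgm :: "'a dgm" where
  "zero_dgm = ({}, (\<lambda>_. undefined))"

definition supp :: "'a dgm \<Rightarrow> 'a set" where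
  "supp \<alpha> = snd \<alpha> ` fst \<alpha>"

definition restr_dgm :: "'a dgm \<Rightarrow> 'a set \<Rightarrow> 'a dgm" where
  "restr_dgm \<alpha> B = ({i \<in> fst \<alpha>. snd \<alpha> i \<in> B}, snd \<alpha>)"

definition upper :: "('a \<Rightarrow> 'a \<Rightarrow> ennreal) \<Rightarrow> 'a set \<Rightarrow> ennreal \<Rightarrow> 'a dgm \<Rightarrow> 'a dgm" where
  "upper d A \<delta> \<alpha> = restr_dgm \<alpha> (- thick d A \<delta>)"

definition lower :: "('a \<Rightarrow> 'a \<Rightarrow> ennreal) \<Rightarrow> 'a set \<Rightarrow> ennreal \<Rightarrow> 'a dgm \<Rightarrow> 'a dgm" where
  "lower d A \<delta> \<alpha> = restr_dgm \<alpha> (thick d A \<delta> - A)"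

type_synonym 'a matching = "nat set \<times> (nat \<Rightarrow> nat) \<times> (nat \<Rightarrow> 'a) \<times> (nat \<Rightarrow> 'a)"

definition is_matching :: "'a set \<Rightarrow> 'a dgm \<Rightarrow> 'a dgm \<Rightarrow> 'a matching \<Rightarrow> bool" where
  "is_matching A \<alpha> \<beta> m \<longleftrightarrow> (case m of (K, \<phi>, z, w) \<Rightarrow>
      K \<subseteq> fst \<alpha> \<and> \<phi> ` K \<subseteq> fst \<beta> \<and> inj_on \<phi> K \<and>
      (\<forall>i\<in>fst \<alpha> - K. z i \<in> A) \<and> (\<forall>j\<in>fst \<beta> - \<phi> ` K. w j \<in> A))"

definition epowr :: "ennreal \<Rightarrow> real \<Rightarrow> ennreal" where
  "epowr c q = (if c = \<infinity> then \<infinity> else ennreal (enn2real c powr q))"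

definition pcost :: "('a \<Rightarrow> 'a \<Rightarrow> ennreal) \<Rightarrow> real \<Rightarrow> 'a dgm \<Rightarrow> 'a dgm \<Rightarrow> 'a matching \<Rightarrow> ennreal" where
  "pcost d p \<alpha> \<beta> m = (case m of (K, \<phi>, z, w) \<Rightarrow>
     epowr ((\<Sum>\<^sub>\<infinity>k\<in>K. epowr (d (snd \<alpha> k) (snd \<beta> (\<phi> k))) p)
          + (\<Sum>\<^sub>\<infinity>i\<in>fst \<alpha> - K. epowr (d (snd \<alpha> i) (z i)) p)
          + (\<Sum>\<^sub>\<infinity>j\<in>fst \<beta> - \<phi> ` K. epowr (d (w j) (snd \<beta> j)) p)) (1 / p))"

definition icost :: "('a \<Rightarrow> 'a \<Rightarrow> ennreal) \<Rightarrow> 'a dgm \<Rightarrow> 'a dgm \<Rightarrow> 'a matching \<Rightarrow> ennreal" where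
  "icost d \<alpha> \<beta> m = (case m of (K, \<phi>, z, w) \<Rightarrow>
     sup (sup (SUP k\<in>K. d (snd \<alpha> k) (snd \<beta> (\<phi> k)))
              (SUP i\<in>fst \<alpha> - K. d (snd \<alpha> i) (z i)))
         (SUP j\<in>fst \<beta> - \<phi> ` K. d (w j) (snd \<beta> j)))"

definition Wp :: "('a \<Rightarrow> 'a \<Rightarrow> ennreal) \<Rightarrow> 'a set \<Rightarrow> real \<Rightarrow> 'a dgm \<Rightarrow> 'a dgm \<Rightarrow> ennreal" where
  "Wp d A p \<alpha> \<beta> = (INF m\<in>{m. is_matching A \<alpha> \<beta> m}. pcost d p \<alpha> \<beta> m)"

definition Winf :: "('a \<Rightarrow> 'a \<Rightarrow> ennreal) \<Rightarrow> 'a set \<Rightarrow> 'a dgm \<Rightarrow> 'a dgm \<Rightarrow> ennreal" where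
  "Winf d A \<alpha> \<beta> = (INF m\<in>{m. is_matching A \<alpha> \<beta> m}. icost d \<alpha> \<beta> m)"

definition Dp :: "('a \<Rightarrow> 'a \<Rightarrow> ennreal) \<Rightarrow> 'a set \<Rightarrow> real \<Rightarrow> 'a dgm set" where
  "Dp d A p = {\<alpha> \<in> Dbar A. finite (fst (upper d A \<infinity> \<alpha>)) \<and>
                 Wp d A p (lower d A \<infinity> \<alpha>) zero_dgm < \<infinity>}"

definition Dinf :: "('a \<Rightarrow> 'a \<Rightarrow> ennreal) \<Rightarrow> 'a set \<Rightarrow> 'a dgm set" where
  "Dinf d A = {\<alpha> \<in> Dbar A. \<forall>\<delta>::real. \<delta> > 0 \<longrightarrow> finite (fst (upper d A (ennreal \<delta>) \<alpha>))}"

definition unif_upper_finite :: "('a \<Rightarrow> 'a \<Rightarrow> ennreal) \<Rightarrow> 'a set \<Rightarrow> 'a dgm set \<Rightarrow> bool" where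
  "unif_upper_finite d A S \<longleftrightarrow> (\<forall>\<epsilon>::real. \<epsilon> > 0 \<longrightarrow> (\<exists>M::nat. \<forall>\<alpha>\<in>S.
      finite (fst (upper d A (ennreal \<epsilon>) \<alpha>)) \<and> card (fst (upper d A (ennreal \<epsilon>) \<alpha>)) \<le> M))"

definition upper_rel_compact :: "('a \<Rightarrow> 'a \<Rightarrow> ennreal) \<Rightarrow> 'a set \<Rightarrow> 'a dgm set \<Rightarrow> bool" where
  "upper_rel_compact d A S \<longleftrightarrow> (\<forall>\<epsilon>::real. \<epsilon> > 0 \<longrightarrow>
      rel_compact_in (ball_topology UNIV d) (\<Union>\<alpha>\<in>S. supp (upper d A (ennreal \<epsilon>) \<alpha>)))"

definition unif_p_vanishing :: "('a \<Rightarrow> 'a \<Rightarrow> ennreal) \<Rightarrow> 'a set \<Rightarrow> real \<Rightarrow> 'a dgm set \<Rightarrow> bool" where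
  "unif_p_vanishing d A p S \<longleftrightarrow> (\<forall>\<epsilon>::real. \<epsilon> > 0 \<longrightarrow> (\<exists>\<delta>::real. \<delta> > 0 \<and> (\<forall>\<alpha>\<in>S.
      Wp d A p (lower d A (ennreal \<delta>) \<alpha>) zero_dgm < ennreal \<epsilon>)))"

end

theory Submission
  imports Defs "HOL-Library.Diagonal_Subsequence"
begin

text \<open>
  Write the cost of a matching as a norm \<open>N\<close> of the family of distances of paired points; \<open>N\<close> is the
  \<open>\<ell>\<^sup>p\<close> or the sup norm, and only monotonicity under injective reindexing, the triangle inequality
  and a Fatou property matter.  Compactness of closures is tested on sequences.

  If \<open>S\<close> is relatively compact, take a convergent subsequence of a hypothetical violating sequence:
  a point at distance at least \<open>\<epsilon>\<close> from \<open>A\<close> can only be matched, at cost less than \<open>\<epsilon>/2\<close>, with one of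
  the finitely many points of the limit at distance at least \<open>\<epsilon>/2\<close> from \<open>A\<close>; and a point of distance
  less than \<open>\<delta>\<close> to \<open>A\<close> matched with one at distance at least \<open>2\<delta>\<close> pays at least its distance to \<open>A\<close>.

  Conversely, enumerate the points of every diagram of \<open>S\<close> shell by shell, so that for each \<open>k\<close> the
  points at distance at least \<open>1/(k+1)\<close> from \<open>A\<close> receive indices in a finite set \<open>H k\<close> not depending on
  the diagram.  A diagonal argument yields a subsequence along which, for each index, the points with
  that index either converge to a point off \<open>A\<close> or approach \<open>A\<close> (or cease to exist).  The limit
  points form the limit diagram; uniform vanishing controls the tails outside \<open>H k\<close>.
\<close>

section \<open>Compactness in extended pseudometric spaces\<close>

text \<open>Three obstacles shape the argument. First, \<open>d\<close> and \<open>W\<close> may be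
  infinite and may vanish between distinct points, so compactness is treated for pseudometrics with
  values in [0, infinity], where limits are not unique. Second, the distance to \<open>A\<close>
  need not be attained: sending a point to \<open>A\<close> is only known to cost at most twice that
  distance. The resulting constants are harmless, since every condition quantifies over all
  \<epsilon>. Third, convergence index by index does not give convergence in \<open>W\<close>,
  because infinitely many indices converge at unrelated rates. Hence the matching with the limit
  pairs only indices in one finite \<open>H k\<close> and sends all remaining points of both
  diagrams to \<open>A\<close>, even those whose index has a limit point. The set \<open>DN\<close>
  describes both kinds of diagram space at once: finitely many points away from \<open>A\<close>,
  and small norm of the distances near \<open>A\<close>. For the sup norm the second property holds
  for every family, and so does its uniform version; this is why vanishing appears as a condition
  only for finite p.\<close>

lemma ennreal_tendsto_0I:
  fixes g :: "nat \<Rightarrow> ennreal"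
  assumes "\<And>r::real. 0 < r \<Longrightarrow> \<forall>\<^sub>F n in sequentially. g n < ennreal r"
  shows "g \<longlonglongrightarrow> 0"
proof (rule order_tendstoI)
  fix a :: ennreal assume "0 < a"
  then obtain b where b: "0 < b" "b < a" using dense by blast
  define r where "r = enn2real b"
  have "b < top" using b(2) by (rule less_le_trans) simp
  then have "ennreal r = b" unfolding r_def by simp
  then have r: "0 < r" "ennreal r < a" using b by (auto simp: ennreal_less_zero_iff)
  show "\<forall>\<^sub>F n in sequentially. g n < a"
    using assms[OF r(1)] by eventually_elim (use r in auto)
qed simp

lemma ennreal_pos_real_below:
  fixes e :: ennreal assumes "0 < e"
  obtains r :: real where "0 < r" "ennreal r \<le> e"
proof (cases e)
  case (real x)
  then show ?thesis using assms that[of x] by (simp add: ennreal_less_zero_iff)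
next
  case top
  then show ?thesis using that[of 1] by simp
qed

lemma tendsto_0_ex_less:
  fixes g :: "nat \<Rightarrow> ennreal"
  assumes "g \<longlonglongrightarrow> 0" "0 < e"
  obtains n where "g n < e"
  using order_tendstoD(2)[OF assms] unfolding eventually_sequentially by blast

lemma tendsto_0_le_ennreal:
  fixes g h :: "nat \<Rightarrow> ennreal"
  assumes "g \<longlonglongrightarrow> 0" "\<And>n. h n \<le> g n"
  shows "h \<longlonglongrightarrow> 0"
  using assms(2) by (intro tendsto_sandwich[OF _ _ tendsto_const assms(1)]) auto

lemma inverse_nat_tendsto_0: "(\<lambda>n. ennreal (inverse (real (Suc n)))) \<longlonglongrightarrow> 0"
  using tendsto_ennrealI[OF LIMSEQ_inverse_real_of_nat] by simp

lemma subseq_tendsto_0: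
  fixes g :: "nat \<Rightarrow> ennreal"
  assumes "\<And>e m. 0 < e \<Longrightarrow> \<exists>n\<ge>m. g n < e"
  obtains r :: "nat \<Rightarrow> nat" where "strict_mono r" "(\<lambda>n. g (r n)) \<longlonglongrightarrow> 0"
proof -
  have "\<forall>k m. \<exists>n>m. g n < ennreal (inverse (real (Suc k)))"
  proof (intro allI)
    fix k m show "\<exists>n>m. g n < ennreal (inverse (real (Suc k)))"
      using assms[of "ennreal (inverse (real (Suc k)))" "Suc m"] by (auto simp: ennreal_less_zero_iff Suc_le_eq)
  qed
  then obtain h where h: "\<And>k m. h k m > m" "\<And>k m. g (h k m) < ennreal (inverse (real (Suc k)))"
    by metis
  define r where "r = rec_nat (h 0 0) (\<lambda>k m. h (Suc k) m)"
  have r: "strict_mono r" unfolding strict_mono_Suc_iff r_def using h(1) by simp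
  have "\<exists>m. r k = h k m" for k by (cases k) (auto simp: r_def)
  then have "g (r k) < ennreal (inverse (real (Suc k)))" for k using h(2) by metis
  then have "(\<lambda>n. g (r n)) \<longlonglongrightarrow> 0"
    by (intro tendsto_0_le_ennreal[OF inverse_nat_tendsto_0] less_imp_le)
  then show ?thesis using that r by simp
qed

locale ext_pmetric_on =
  fixes D :: "'b set" and f :: "'b \<Rightarrow> 'b \<Rightarrow> ennreal"
  assumes refl0: "x \<in> D \<Longrightarrow> f x x = 0"
    and sym: "x \<in> D \<Longrightarrow> y \<in> D \<Longrightarrow> f x y = f y x"
    and tri: "x \<in> D \<Longrightarrow> y \<in> D \<Longrightarrow> z \<in> D \<Longrightarrow> f x z \<le> f x y + f y z"
begin

lemma topspace_ball_topology: "topspace (ball_topology D f) = D"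
proof
  show "topspace (ball_topology D f) \<subseteq> D"
    using openin_topspace[of "ball_topology D f"] unfolding openin_ball_topology ball_open_def by blast
  have "openin (ball_topology D f) D"
    unfolding openin_ball_topology ball_open_def using zero_less_one by blast
  then show "D \<subseteq> topspace (ball_topology D f)" by (rule openin_subset)
qed

lemma closure_of_subset_carrier: "ball_topology D f closure_of S \<subseteq> D"
  using closure_of_subset_topspace[of "ball_topology D f" S] topspace_ball_topology by simp

lemma openin_ball:
  assumes "x \<in> D" shows "openin (ball_topology D f) {y\<in>D. f x y < r}"
proof -
  have "\<exists>e>0. \<forall>z\<in>D. f y z < e \<longrightarrow> z \<in> {y\<in>D. f x y < r}" if "y \<in> D" "f x y < r" for y
  proof (intro exI[of _ "r - f x y"] conjI ballI impI)
    show "0 < r - f x y" using that by (simp add: diff_gr0_ennreal)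
    fix z assume z: "z \<in> D" "f y z < r - f x y"
    have "f x z \<le> f x y + f y z" using assms that z tri by blast
    also have "\<dots> < r" using z(2) by (metis add.commute ennreal_add_left_cancel_less add_diff_inverse_ennreal less_diff_eq_ennreal linorder_not_less order_less_imp_le order_top_class.top_greatest that(2) less_top order_less_le)
    finally show "z \<in> {y\<in>D. f x y < r}" using z by simp
  qed
  then show ?thesis unfolding openin_ball_topology ball_open_def by blast
qed

lemma in_closure_of_ball:
  assumes "S \<subseteq> D" "c \<in> ball_topology D f closure_of S" "0 < e"
  obtains s where "s \<in> S" "f c s < e"
proof -
  have c: "c \<in> D" using assms(2) closure_of_subset_carrier by blast
  have "c \<in> {y\<in>D. f c y < e}" using c refl0 assms(3) by simp
  moreover have "\<forall>T. c \<in> T \<and> openin (ball_topology D f) T \<longrightarrow> (\<exists>y. y \<in> S \<and> y \<in> T)"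
    using assms(2) unfolding in_closure_of by (rule conjunct2)
  ultimately obtain s where "s \<in> S" "s \<in> {y\<in>D. f c y < e}"
    using openin_ball[OF c, of e] by meson
  then show ?thesis using that by simp
qed

lemma tendsto_in_closure_of:
  assumes "S \<subseteq> D" "l \<in> D" "\<And>n. s n \<in> ball_topology D f closure_of S" "(\<lambda>n. f l (s n)) \<longlonglongrightarrow> 0"
  shows "l \<in> ball_topology D f closure_of S"
  unfolding in_closure_of
proof (intro conjI allI impI)
  show "l \<in> topspace (ball_topology D f)" using assms topspace_ball_topology by simp
  fix T assume T: "l \<in> T \<and> openin (ball_topology D f) T"
  then obtain e where e: "0 < e" "\<forall>y\<in>D. f l y < e \<longrightarrow> y \<in> T"
    unfolding openin_ball_topology ball_open_def by blast
  have D: "s n \<in> D" for n using assms(3)[of n] closure_of_subset_carrier by blast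
  obtain n where "f l (s n) < e"
    using tendsto_0_ex_less[OF assms(4) e(1)] by blast
  then have "s n \<in> T" using e D by blast
  moreover have "\<forall>T. s n \<in> T \<and> openin (ball_topology D f) T \<longrightarrow> (\<exists>y. y \<in> S \<and> y \<in> T)"
    using assms(3)[of n] unfolding in_closure_of by (rule conjunct2)
  ultimately show "\<exists>y. y \<in> S \<and> y \<in> T" using T by simp
qed

text \<open>A sequence without cluster point in the closure would leave some ball around each point
  of the closure for good; finitely many of these balls cover the closure, hence the whole
  sequence.\<close>

lemma rel_compact_imp_seq:
  assumes S: "S \<subseteq> D" and rc: "rel_compact_in (ball_topology D f) S" and s: "\<And>n::nat. s n \<in> S"
  obtains l r where "l \<in> D" "strict_mono (r::nat \<Rightarrow> nat)" "(\<lambda>n. f l (s (r n))) \<longlonglongrightarrow> 0"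
proof -
  let ?T = "ball_topology D f"
  let ?C = "?T closure_of S"
  have comp: "compactin ?T ?C" using rc unfolding rel_compact_in_def .
  have sC: "s n \<in> ?C" for n using s closure_of_subset[of S ?T] S topspace_ball_topology by auto
  have CD: "?C \<subseteq> D" by (rule closure_of_subset_carrier)
  have "\<exists>l\<in>?C. \<forall>e>0. \<forall>m. \<exists>n\<ge>m. f l (s n) < e"
  proof (rule ccontr)
    assume "\<not> ?thesis"
    then have "\<forall>l\<in>?C. \<exists>e>0. \<exists>m. \<forall>n\<ge>m. \<not> f l (s n) < e" by blast
    then obtain e m where em: "\<And>l. l \<in> ?C \<Longrightarrow> 0 < e l" "\<And>l n. l \<in> ?C \<Longrightarrow> m l \<le> n \<Longrightarrow> \<not> f l (s n) < e l"
      by metis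
    let ?B = "\<lambda>l. {y\<in>D. f l y < e l}"
    have "\<exists>F. finite F \<and> F \<subseteq> ?B ` ?C \<and> ?C \<subseteq> \<Union>F"
    proof (rule compactinD[OF comp])
      show "\<And>U. U \<in> ?B ` ?C \<Longrightarrow> openin ?T U" using openin_ball CD by blast
      have "l \<in> ?B l" if "l \<in> ?C" for l
        using subsetD[OF CD that] refl0[of l] em(1)[OF that] by simp
      then show "?C \<subseteq> \<Union> (?B ` ?C)" by (intro subsetI UN_I)
    qed
    then obtain \<F> where FF: "finite \<F>" "\<F> \<subseteq> ?B ` ?C" "?C \<subseteq> \<Union>\<F>" by blast
    obtain F where F: "finite F" "F \<subseteq> ?C" "?C \<subseteq> \<Union>(?B ` F)"
      using finite_subset_image[OF FF(1,2)] FF(3) by blast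
    \<comment> \<open>An index past the thresholds of all balls of the finite subcover;
      \<open>0\<close> covers the case of an empty \<open>F\<close>.\<close>
    define n where "n = Max (insert 0 (m ` F))"
    obtain l where l: "l \<in> F" "f l (s n) < e l" using sC[of n] F(3) by blast
    have "m l \<le> n" unfolding n_def using F(1) l(1) by (intro Max_ge) auto
    then show False using em(2)[of l n] l F(2) by blast
  qed
  then obtain l where l: "l \<in> ?C" "\<And>e m. 0 < e \<Longrightarrow> \<exists>n\<ge>m. f l (s n) < e" by blast
  obtain r :: "nat \<Rightarrow> nat" where r: "strict_mono r" "(\<lambda>n. f l (s (r n))) \<longlonglongrightarrow> 0"
    using l(2) by (rule subseq_tendsto_0)
  then show ?thesis using that[of l r] l(1) CD by auto
qed

text \<open>Sequences are tested only in \<open>S\<close>, with limits anywhere in \<open>D\<close>.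
  The property is first carried over to the closure; then total boundedness and a Lebesgue number
  give finite subcovers.\<close>

lemma seq_imp_rel_compact:
  assumes S: "S \<subseteq> D"
    and seq: "\<And>s. (\<And>n::nat. s n \<in> S) \<Longrightarrow> \<exists>l\<in>D. \<exists>r::nat\<Rightarrow>nat. strict_mono r \<and> (\<lambda>n. f l (s (r n))) \<longlonglongrightarrow> 0"
  shows "rel_compact_in (ball_topology D f) S"
proof -
  let ?T = "ball_topology D f"
  let ?C = "?T closure_of S"
  have CD: "?C \<subseteq> D" by (rule closure_of_subset_carrier)
  have seqC: "\<exists>l\<in>?C. \<exists>r::nat\<Rightarrow>nat. strict_mono r \<and> (\<lambda>n. f l (c (r n))) \<longlonglongrightarrow> 0"
    if c: "\<And>n::nat. c n \<in> ?C" for c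
  proof -
    \<comment> \<open>Each \<open>c n\<close> is shadowed by a point of \<open>S\<close> with error
      tending to 0, so a limit of the shadows is a limit of \<open>c\<close>.\<close>
    have "\<forall>n. \<exists>s\<in>S. f (c n) s < ennreal (inverse (real (Suc n)))"
      by (metis in_closure_of_ball[OF S c] ennreal_less_zero_iff inverse_positive_iff_positive of_nat_0_less_iff zero_less_Suc)
    then obtain s where s: "\<And>n. s n \<in> S" "\<And>n. f (c n) (s n) < ennreal (inverse (real (Suc n)))"
      by metis
    obtain l r where l: "l \<in> D" and r: "strict_mono r" and lim: "(\<lambda>n. f l (s (r n))) \<longlonglongrightarrow> 0"
      using seq[of s] s(1) by blast
    have lim': "(\<lambda>n. f l (s (r n)) + ennreal (inverse (real (Suc (r n))))) \<longlonglongrightarrow> 0"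
      using tendsto_add[OF lim LIMSEQ_subseq_LIMSEQ[OF inverse_nat_tendsto_0 r]] by (simp add: o_def)
    have "f l (c (r n)) \<le> f l (s (r n)) + ennreal (inverse (real (Suc (r n))))" for n
    proof -
      have D: "c (r n) \<in> D" "s (r n) \<in> D" using c CD s S by auto
      have "f l (c (r n)) \<le> f l (s (r n)) + f (s (r n)) (c (r n))" using tri l D by blast
      also have "\<dots> \<le> f l (s (r n)) + ennreal (inverse (real (Suc (r n))))"
        using s(2)[of "r n"] sym D by (intro add_left_mono) (auto simp: less_imp_le)
      finally show ?thesis .
    qed
    then have limc: "(\<lambda>n. f l (c (r n))) \<longlonglongrightarrow> 0"
      by (rule tendsto_0_le_ennreal[OF lim'])
    then have "l \<in> ?C" using tendsto_in_closure_of[OF S l _ limc] c by blast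
    then show ?thesis using r limc by blast
  qed
  have tb: "\<exists>F. finite F \<and> F \<subseteq> ?C \<and> ?C \<subseteq> (\<Union>x\<in>F. {y\<in>D. f x y < e})" if e: "0 < e" for e
  proof (rule ccontr)
    assume neg: "\<not> ?thesis"
    have "\<exists>y\<in>?C. \<forall>x\<in>F. \<not> f x y < e" if "finite F" "F \<subseteq> ?C" for F
    proof (rule ccontr)
      assume "\<not> ?thesis"
      then have "?C \<subseteq> (\<Union>x\<in>F. {y\<in>D. f x y < e})" using CD by auto
      then show False using neg that by auto
    qed
    then have "\<forall>F. \<exists>y. finite F \<longrightarrow> F \<subseteq> ?C \<longrightarrow> y \<in> ?C \<and> (\<forall>x\<in>F. \<not> f x y < e)" by (simp add: Bex_def)
    then obtain g where g: "\<And>F. finite F \<Longrightarrow> F \<subseteq> ?C \<Longrightarrow> g F \<in> ?C \<and> (\<forall>x\<in>F. \<not> f x (g F) < e)"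
      unfolding choice_iff by blast
    \<comment> \<open>Greedy choice: \<open>h n\<close> collects the first n points, and
      \<open>g (h n)\<close> lies outside all their \<open>e\<close>-balls. The resulting separated
      sequence has no convergent subsequence.\<close>
    define h where "h = rec_nat {} (\<lambda>_ F. insert (g F) F)"
    have h: "finite (h n) \<and> h n \<subseteq> ?C" for n by (induction n) (use g in \<open>auto simp: h_def\<close>)
    have hm: "h m \<subseteq> h n" if "m \<le> n" for m n using that by (induction n rule: dec_induct) (auto simp: h_def)
    have cC: "g (h n) \<in> ?C" for n using g h by blast
    have sep: "\<not> f (g (h m)) (g (h n)) < e" if "m < n" for m n
    proof -
      have "g (h m) \<in> h (Suc m)" by (simp add: h_def)
      then have "g (h m) \<in> h n" using hm[of "Suc m" n] that by auto
      then show ?thesis using g h by blast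
    qed
    obtain l r where l: "l \<in> ?C" and r: "strict_mono (r::nat\<Rightarrow>nat)" and lim: "(\<lambda>n. f l (g (h (r n)))) \<longlonglongrightarrow> 0"
      using seqC[of "\<lambda>n. g (h n)"] cC by blast
    have "(\<lambda>n. f l (g (h (r n))) + f l (g (h (r (Suc n))))) \<longlonglongrightarrow> 0"
      using tendsto_add[OF lim LIMSEQ_Suc[OF lim]] by simp
    then obtain n where n: "f l (g (h (r n))) + f l (g (h (r (Suc n)))) < e"
      using e by (rule tendsto_0_ex_less)
    have D: "l \<in> D" "g (h (r n)) \<in> D" "g (h (r (Suc n))) \<in> D" using l cC CD by auto
    have "f (g (h (r n))) (g (h (r (Suc n)))) \<le> f l (g (h (r n))) + f l (g (h (r (Suc n))))"
      using tri[of "g (h (r n))" l "g (h (r (Suc n)))"] sym D by simp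
    also note n
    finally have "f (g (h (r n))) (g (h (r (Suc n)))) < e" .
    then show False using sep[of "r n" "r (Suc n)"] r by (simp add: strict_mono_Suc_iff)
  qed
  have "\<exists>F. finite F \<and> F \<subseteq> \<U> \<and> ?C \<subseteq> \<Union>F" if op: "\<And>U. U \<in> \<U> \<Longrightarrow> openin ?T U" and cov: "?C \<subseteq> \<Union>\<U>" for \<U>
  proof -
    \<comment> \<open>Lebesgue number of the cover: otherwise centres of bad balls of radius 1/(n+1)
      accumulate at some \<open>l\<close>, and a member of the cover around \<open>l\<close>
      swallows one of these balls.\<close>
    have "\<exists>n::nat. \<forall>x\<in>?C. \<exists>U\<in>\<U>. \<forall>y\<in>D. f x y < ennreal (inverse (real (Suc n))) \<longrightarrow> y \<in> U"
    proof (rule ccontr)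
      assume "\<not> ?thesis"
      then have "\<forall>n. \<exists>x. x \<in> ?C \<and> (\<forall>U\<in>\<U>. \<exists>y\<in>D. f x y < ennreal (inverse (real (Suc n))) \<and> y \<notin> U)"
        by (simp add: Bex_def Ball_def del: of_nat_Suc)
      then obtain x where x: "\<And>n. x n \<in> ?C"
        and nU: "\<And>n U. U \<in> \<U> \<Longrightarrow> \<exists>y\<in>D. f (x n) y < ennreal (inverse (real (Suc n))) \<and> y \<notin> U"
        unfolding choice_iff by blast
      obtain l r where l: "l \<in> ?C" and r: "strict_mono (r::nat\<Rightarrow>nat)" and lim: "(\<lambda>n. f l (x (r n))) \<longlonglongrightarrow> 0"
        using seqC[of x] x by blast
      obtain U where U: "U \<in> \<U>" "l \<in> U" using l cov by blast
      then obtain e where e: "0 < e" "\<forall>y\<in>D. f l y < e \<longrightarrow> y \<in> U"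
        using op[OF U(1)] unfolding openin_ball_topology ball_open_def by blast
      have "(\<lambda>n. f l (x (r n)) + ennreal (inverse (real (Suc (r n))))) \<longlonglongrightarrow> 0"
        using tendsto_add[OF lim LIMSEQ_subseq_LIMSEQ[OF inverse_nat_tendsto_0 r]] by (simp add: o_def)
      then obtain n where n: "f l (x (r n)) + ennreal (inverse (real (Suc (r n)))) < e"
        using e(1) by (rule tendsto_0_ex_less)
      obtain y where y: "y \<in> D" "f (x (r n)) y < ennreal (inverse (real (Suc (r n))))" "y \<notin> U"
        using nU[OF U(1)] by blast
      have "f l y \<le> f l (x (r n)) + f (x (r n)) y" using tri l x y CD by blast
      also have "\<dots> \<le> f l (x (r n)) + ennreal (inverse (real (Suc (r n))))"
        using y(2) by (intro add_left_mono) (auto simp: less_imp_le)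
      also note n
      finally show False using e(2) y by blast
    qed
    then obtain n where n: "\<And>x. x \<in> ?C \<Longrightarrow> \<exists>U\<in>\<U>. \<forall>y\<in>D. f x y < ennreal (inverse (real (Suc n))) \<longrightarrow> y \<in> U" by blast
    then obtain V where V: "\<And>x. x \<in> ?C \<Longrightarrow> V x \<in> \<U>"
      "\<And>x y. x \<in> ?C \<Longrightarrow> y \<in> D \<Longrightarrow> f x y < ennreal (inverse (real (Suc n))) \<Longrightarrow> y \<in> V x" by metis
    obtain F where F: "finite F" "F \<subseteq> ?C" "?C \<subseteq> (\<Union>x\<in>F. {y\<in>D. f x y < ennreal (inverse (real (Suc n)))})"
      using tb[of "ennreal (inverse (real (Suc n)))"] by (auto simp: ennreal_less_zero_iff)
    have "?C \<subseteq> \<Union>(V ` F)" using F V(2) by blast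
    then show ?thesis using F V(1) by (intro exI[of _ "V ` F"]) auto
  qed
  then have "compactin ?T ?C" unfolding compactin_def by (simp add: closure_of_subset_topspace)
  then show ?thesis unfolding rel_compact_in_def .
qed

end

section \<open>Matching distances for an abstract norm\<close>

lemma ext_metricD:
  assumes "ext_metric d"
  shows "d x x = 0" "d x y = d y x" "d x z \<le> d x y + d y z"
  using assms unfolding ext_metric_def by blast+

text \<open>\<open>N_inj\<close> joins monotonicity with injective transport of indices; injectivity
  is asked only on the support, so a reindexing may be arbitrary where the family vanishes. The
  index type nat + nat leaves room for the points of two diagrams at once.\<close>

locale cost_norm =
  fixes N :: "(nat + nat \<Rightarrow> ennreal) \<Rightarrow> ennreal"
  assumes N_inj: "inj_on \<sigma> {i. g i \<noteq> 0} \<Longrightarrow> (\<And>i. g i \<noteq> 0 \<Longrightarrow> g i \<le> h (\<sigma> i)) \<Longrightarrow> N g \<le> N h"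
    and N_add: "N (\<lambda>i. g i + h i) \<le> N g + N h"
    and N_point: "g i \<le> N g"
    and N_single: "N (\<lambda>i. if i = a then c else 0) \<le> c"
    and N_Fatou: "(\<And>F. finite F \<Longrightarrow> N (\<lambda>i. if i \<in> F then g i else 0) \<le> c) \<Longrightarrow> N g \<le> c"
begin

lemma N_mono: "(\<And>i. g i \<le> h i) \<Longrightarrow> N g \<le> N h"
  by (rule N_inj[where \<sigma> = id]) auto

lemma N_zero: "N (\<lambda>_. 0) = 0"
  using N_single[of undefined 0] by simp

text \<open>A crude triangle bound, one summand per index. It suffices because it is applied to
  finite index sets fixed before the tolerance \<open>c\<close> is chosen.\<close>

lemma N_finite:
  assumes "finite F" "\<And>i. i \<in> F \<Longrightarrow> g i \<le> c" "\<And>i. i \<notin> F \<Longrightarrow> g i = 0"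
  shows "N g \<le> of_nat (card F) * c"
  using assms
proof (induction F arbitrary: g rule: finite_induct)
  case empty
  then have "g = (\<lambda>_. 0)" by auto
  then show ?case using N_zero by simp
next
  case (insert a F)
  let ?g = "\<lambda>i. if i = a then 0 else g i" and ?s = "\<lambda>i. if i = a then g a else 0"
  have "N g = N (\<lambda>i. ?s i + ?g i)" by (rule arg_cong[of _ _ N]) auto
  also have "\<dots> \<le> N ?s + N ?g" by (rule N_add)
  also have "N ?g \<le> of_nat (card F) * c"
    using insert.prems by (intro insert.IH) auto
  also have "N ?s \<le> c" by (rule order_trans[OF N_single]) (use insert.prems in auto)
  finally show ?case using insert.hyps by (simp add: distrib_right add_mono add_right_mono add_left_mono)
qed

end

text \<open>\<open>Inl i\<close> indexes the points of the first diagram, matched or not; \<open>Inr j\<close> indexes the unmatched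
  points of the second one.\<close>

definition mcost :: "('a \<Rightarrow> 'a \<Rightarrow> ennreal) \<Rightarrow> 'a dgm \<Rightarrow> 'a dgm \<Rightarrow> 'a matching \<Rightarrow> nat + nat \<Rightarrow> ennreal" where
  "mcost d \<alpha> \<beta> m = (case m of (K, \<phi>, z, w) \<Rightarrow>
     case_sum (\<lambda>i. if i \<in> fst \<alpha> then d (snd \<alpha> i) (if i \<in> K then snd \<beta> (\<phi> i) else z i) else 0)
              (\<lambda>j. if j \<in> fst \<beta> - \<phi> ` K then d (w j) (snd \<beta> j) else 0))"

lemma mcost_simps:
  "mcost d \<alpha> \<beta> (K, \<phi>, z, w) (Inl i) = (if i \<in> fst \<alpha> then d (snd \<alpha> i) (if i \<in> K then snd \<beta> (\<phi> i) else z i) else 0)"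
  "mcost d \<alpha> \<beta> (K, \<phi>, z, w) (Inr j) = (if j \<in> fst \<beta> - \<phi> ` K then d (w j) (snd \<beta> j) else 0)"
  by (simp_all add: mcost_def)

locale diagram_norm = cost_norm +
  fixes d :: "'a \<Rightarrow> 'a \<Rightarrow> ennreal" and A :: "'a set"
  assumes mp: "metric_pair d A"
begin

lemma d_metric: "ext_metric d" using mp unfolding metric_pair_def by simp
lemmas d_refl = ext_metricD(1)[OF d_metric]
lemmas d_sym = ext_metricD(2)[OF d_metric]
lemmas d_tri = ext_metricD(3)[OF d_metric]

section \<open>The matching distance as an extended pseudometric\<close>

definition W :: "'a dgm \<Rightarrow> 'a dgm \<Rightarrow> ennreal" where
  "W \<alpha> \<beta> = (INF m\<in>{m. is_matching A \<alpha> \<beta> m}. N (mcost d \<alpha> \<beta> m))"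

lemma W_lessE:
  assumes "W \<alpha> \<beta> < c"
  obtains K \<phi> z w where "is_matching A \<alpha> \<beta> (K, \<phi>, z, w)" "N (mcost d \<alpha> \<beta> (K, \<phi>, z, w)) < c"
proof -
  obtain m where "is_matching A \<alpha> \<beta> m" "N (mcost d \<alpha> \<beta> m) < c"
    using assms unfolding W_def INF_less_iff by auto
  then show ?thesis using that by (cases m) auto
qed

lemma W_le:
  assumes "is_matching A \<alpha> \<beta> m" shows "W \<alpha> \<beta> \<le> N (mcost d \<alpha> \<beta> m)"
  unfolding W_def using assms by (intro INF_lower) simp

lemma W_refl: "W \<alpha> \<alpha> = 0"
proof -
  let ?m = "(fst \<alpha>, id, \<lambda>_. undefined, \<lambda>_. undefined)"
  have "is_matching A \<alpha> \<alpha> ?m" unfolding is_matching_def by simp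
  then have "W \<alpha> \<alpha> \<le> N (mcost d \<alpha> \<alpha> ?m)" by (rule W_le)
  also have "mcost d \<alpha> \<alpha> ?m = (\<lambda>_. 0)"
  proof
    fix u show "mcost d \<alpha> \<alpha> ?m u = 0" by (cases u) (simp_all add: mcost_simps d_refl)
  qed
  finally show ?thesis using N_zero by simp
qed

lemma W_sym_le: "W \<alpha> \<beta> \<le> W \<beta> \<alpha>"
  unfolding W_def[of \<beta> \<alpha>]
proof (rule INF_greatest, clarify)
  fix K \<phi> z w assume m: "is_matching A \<beta> \<alpha> (K, \<phi>, z, w)"
  let ?i = "inv_into K \<phi>"
  let ?m = "(\<phi> ` K, ?i, w, z)"
  have inj: "inj_on \<phi> K" and K: "K \<subseteq> fst \<beta>" and \<phi>K: "\<phi> ` K \<subseteq> fst \<alpha>"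
    and z: "\<And>i. i \<in> fst \<beta> - K \<Longrightarrow> z i \<in> A" and w: "\<And>i. i \<in> fst \<alpha> - \<phi> ` K \<Longrightarrow> w i \<in> A"
    using m unfolding is_matching_def by simp_all
  have img: "?i ` \<phi> ` K = K" using inj by (simp add: image_image inv_into_f_f)
  have m': "is_matching A \<alpha> \<beta> ?m"
    unfolding is_matching_def using K \<phi>K z w img by (auto intro: inj_on_inv_into)
  \<comment> \<open>A pair is indexed by its point in the first diagram, so reversing a matching
    sends matched points through the inverse of \<phi> and lets unmatched points change
    sides.\<close>
  define \<sigma> :: "nat + nat \<Rightarrow> nat + nat" where
    "\<sigma> = case_sum (\<lambda>i. if i \<in> \<phi> ` K then Inl (?i i) else Inr i) Inl"
  have "N (mcost d \<alpha> \<beta> ?m) \<le> N (mcost d \<beta> \<alpha> (K, \<phi>, z, w))"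
  proof (rule N_inj[where \<sigma> = \<sigma>])
    have 1: "i \<in> fst \<alpha>" if "mcost d \<alpha> \<beta> ?m (Inl i) \<noteq> 0" for i
      using that by (simp add: mcost_simps split: if_splits)
    have 2: "i \<in> fst \<beta> - K" if "mcost d \<alpha> \<beta> ?m (Inr i) \<noteq> 0" for i
      using that by (simp add: mcost_simps img split: if_splits)
    have 3: "?i i \<in> K" if "i \<in> \<phi> ` K" for i using that by (rule inv_into_into)
    show "inj_on \<sigma> {i. mcost d \<alpha> \<beta> ?m i \<noteq> 0}"
    proof (rule inj_onI; clarify)
      fix u v assume u: "mcost d \<alpha> \<beta> ?m u \<noteq> 0" and v: "mcost d \<alpha> \<beta> ?m v \<noteq> 0" and e: "\<sigma> u = \<sigma> v"
      show "u = v"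
      proof (cases u; cases v)
        fix i j assume "u = Inl i" "v = Inl j"
        then show ?thesis using e by (auto simp: \<sigma>_def inj inv_into_f_f split: if_splits)
      next
        fix i j assume "u = Inl i" "v = Inr j"
        then show ?thesis using e 2[of j] v 3[of i] by (auto simp: \<sigma>_def split: if_splits)
      next
        fix i j assume "u = Inr i" "v = Inl j"
        then show ?thesis using e 2[of i] u 3[of j] by (auto simp: \<sigma>_def split: if_splits)
      next
        fix i j assume "u = Inr i" "v = Inr j"
        then show ?thesis using e by (auto simp: \<sigma>_def)
      qed
    qed
    fix u assume u: "mcost d \<alpha> \<beta> ?m u \<noteq> 0"
    show "mcost d \<alpha> \<beta> ?m u \<le> mcost d \<beta> \<alpha> (K, \<phi>, z, w) (\<sigma> u)"
    proof (cases u)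
      case (Inl i)
      show ?thesis
      proof (cases "i \<in> \<phi> ` K")
        case True
        then show ?thesis using Inl 1[of i] 3[OF True] K u
          by (auto simp: \<sigma>_def mcost_simps d_sym inj inv_into_f_f)
      next
        case False
        then show ?thesis using Inl 1[of i] u by (auto simp: \<sigma>_def mcost_simps d_sym)
      qed
    next
      case (Inr j)
      then show ?thesis using 2[of j] u by (auto simp: \<sigma>_def mcost_simps d_sym img)
    qed
  qed
  then show "W \<alpha> \<beta> \<le> N (mcost d \<beta> \<alpha> (K, \<phi>, z, w))" using W_le[OF m'] by (rule order_trans[rotated])
qed

lemma W_sym: "W \<alpha> \<beta> = W \<beta> \<alpha>"
  by (intro antisym W_sym_le)

text \<open>Pairs are glued along common points of \<beta>. A point whose chain stops in \<beta> is
  sent to the point of \<open>A\<close> used there by the other matching. Each distance of the glued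
  matching is then at most the sum of the distances along its chain.\<close>

lemma matching_compose:
  assumes m1: "is_matching A \<alpha> \<beta> (K1, \<phi>1, z1, w1)" and m2: "is_matching A \<beta> \<gamma> (K2, \<phi>2, z2, w2)"
  shows "W \<alpha> \<gamma> \<le> N (mcost d \<alpha> \<beta> (K1, \<phi>1, z1, w1)) + N (mcost d \<beta> \<gamma> (K2, \<phi>2, z2, w2))"
proof -
  let ?i = "inv_into K2 \<phi>2"
  define K where "K = {k\<in>K1. \<phi>1 k \<in> K2}"
  define z where "z i = (if i \<in> K1 then z2 (\<phi>1 i) else z1 i)" for i
  define w where "w l = (if l \<in> \<phi>2 ` K2 then w1 (?i l) else w2 l)" for l
  let ?m = "(K, \<phi>2 \<circ> \<phi>1, z, w)"
  let ?m1 = "(K1, \<phi>1, z1, w1)" and ?m2 = "(K2, \<phi>2, z2, w2)"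
  have inj1: "inj_on \<phi>1 K1" and K1: "K1 \<subseteq> fst \<alpha>" and \<phi>K1: "\<And>k. k \<in> K1 \<Longrightarrow> \<phi>1 k \<in> fst \<beta>"
    and z1: "\<And>i. i \<in> fst \<alpha> - K1 \<Longrightarrow> z1 i \<in> A" and w1: "\<And>i. i \<in> fst \<beta> - \<phi>1 ` K1 \<Longrightarrow> w1 i \<in> A"
    using m1 unfolding is_matching_def by auto
  have inj2: "inj_on \<phi>2 K2" and K2: "K2 \<subseteq> fst \<beta>" and \<phi>K2: "\<And>k. k \<in> K2 \<Longrightarrow> \<phi>2 k \<in> fst \<gamma>"
    and z2: "\<And>i. i \<in> fst \<beta> - K2 \<Longrightarrow> z2 i \<in> A" and w2: "\<And>i. i \<in> fst \<gamma> - \<phi>2 ` K2 \<Longrightarrow> w2 i \<in> A"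
    using m2 unfolding is_matching_def by auto
  have ii: "?i l \<in> K2" "\<phi>2 (?i l) = l" if "l \<in> \<phi>2 ` K2" for l
    using that by (auto intro: inv_into_into f_inv_into_f)
  have notin: "?i l \<notin> \<phi>1 ` K1" if "l \<in> \<phi>2 ` K2" "l \<notin> (\<phi>2 \<circ> \<phi>1) ` K" for l
  proof
    assume "?i l \<in> \<phi>1 ` K1"
    then obtain k where k: "k \<in> K1" "?i l = \<phi>1 k" by blast
    then have "k \<in> K" using ii(1)[OF that(1)] unfolding K_def by simp
    moreover have "l = (\<phi>2 \<circ> \<phi>1) k" using ii(2)[OF that(1)] k by simp
    ultimately show False using that(2) by blast
  qed
  have m: "is_matching A \<alpha> \<gamma> ?m"
    unfolding is_matching_def prod.case
  proof (intro conjI ballI)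
    show "K \<subseteq> fst \<alpha>" using K1 unfolding K_def by auto
    show "(\<phi>2 \<circ> \<phi>1) ` K \<subseteq> fst \<gamma>" using \<phi>K2 unfolding K_def by auto
    show "inj_on (\<phi>2 \<circ> \<phi>1) K"
      using inj1 inj2 unfolding K_def inj_on_def by auto
    show "z i \<in> A" if "i \<in> fst \<alpha> - K" for i
      using that z1 z2 \<phi>K1 unfolding z_def K_def by auto
    show "w l \<in> A" if l: "l \<in> fst \<gamma> - (\<phi>2 \<circ> \<phi>1) ` K" for l
    proof (cases "l \<in> \<phi>2 ` K2")
      case True
      then have "?i l \<in> fst \<beta> - \<phi>1 ` K1" using ii(1)[OF True] K2 notin[OF True] l by auto
      then show ?thesis using w1 True unfolding w_def by simp
    next
      case False
      then show ?thesis using w2 l unfolding w_def by simp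
    qed
  qed
  \<comment> \<open>\<open>g1\<close> and \<open>g2\<close> record the first and second leg of every
    chain, indexed like the glued matching. No leg is used by two chains, so both are injective
    rearrangements of parts of the given costs.\<close>
  define g1 where "g1 = case_sum (\<lambda>i. mcost d \<alpha> \<beta> ?m1 (Inl i))
    (\<lambda>l. if l \<in> \<phi>2 ` K2 \<and> l \<notin> (\<phi>2 \<circ> \<phi>1) ` K then mcost d \<alpha> \<beta> ?m1 (Inr (?i l)) else 0)"
  define g2 where "g2 = case_sum (\<lambda>i. if i \<in> K1 then mcost d \<beta> \<gamma> ?m2 (Inl (\<phi>1 i)) else 0)
    (\<lambda>l. if l \<in> \<phi>2 ` K2 then if l \<in> (\<phi>2 \<circ> \<phi>1) ` K then 0 else mcost d \<beta> \<gamma> ?m2 (Inl (?i l))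
         else mcost d \<beta> \<gamma> ?m2 (Inr l))"
  have "W \<alpha> \<gamma> \<le> N (mcost d \<alpha> \<gamma> ?m)" by (rule W_le[OF m])
  also have "\<dots> \<le> N (\<lambda>u. g1 u + g2 u)"
  proof (rule N_mono)
    fix u show "mcost d \<alpha> \<gamma> ?m u \<le> g1 u + g2 u"
    proof (cases u)
      case (Inl i)
      show ?thesis
      proof (cases "i \<in> K1")
        case True
        then have "i \<in> fst \<alpha>" "\<phi>1 i \<in> fst \<beta>" using K1 \<phi>K1 by auto
        then show ?thesis unfolding Inl g1_def g2_def using True d_tri
          by (auto simp: mcost_simps z_def K_def)
      next
        case False
        then show ?thesis unfolding Inl g1_def g2_def
          by (auto simp: mcost_simps z_def K_def)
      qed
    next
      case (Inr l)
      show ?thesis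
      proof (cases "l \<in> \<phi>2 ` K2 \<and> l \<notin> (\<phi>2 \<circ> \<phi>1) ` K")
        case True
        then have "?i l \<in> K2" "\<phi>2 (?i l) = l" "?i l \<notin> \<phi>1 ` K1" "?i l \<in> fst \<beta>"
          using ii notin K2 by auto
        then show ?thesis unfolding Inr g1_def g2_def using True d_tri
          by (auto simp: mcost_simps w_def)
      next
        case False
        then show ?thesis unfolding Inr g1_def g2_def
          by (auto simp: mcost_simps w_def)
      qed
    qed
  qed
  also have "\<dots> \<le> N g1 + N g2" by (rule N_add)
  also have "N g1 \<le> N (mcost d \<alpha> \<beta> ?m1)"
  proof (rule N_inj[where \<sigma> = "map_sum id ?i"])
    have nz: "l \<in> \<phi>2 ` K2" if "g1 (Inr l) \<noteq> 0" for l
      using that unfolding g1_def by (simp split: if_splits)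
    have inv: "l = l'" if "l \<in> \<phi>2 ` K2" "l' \<in> \<phi>2 ` K2" "?i l = ?i l'" for l l'
      using that ii(2) by metis
    show "inj_on (map_sum id ?i) {u. g1 u \<noteq> 0}"
    proof (rule inj_onI; clarify)
      fix u v assume u: "g1 u \<noteq> 0" and v: "g1 v \<noteq> 0" and e: "map_sum id ?i u = map_sum id ?i v"
      show "u = v" by (cases u; cases v) (use u v e nz inv in auto)
    qed
    fix u assume u: "g1 u \<noteq> 0"
    show "g1 u \<le> mcost d \<alpha> \<beta> ?m1 (map_sum id ?i u)"
      by (cases u) (auto simp: g1_def)
  qed
  also have "N g2 \<le> N (mcost d \<beta> \<gamma> ?m2)"
  proof -
    \<comment> \<open>Both sides can land on a point of \<beta>: chains starting in \<alpha> through
      \<open>\<phi>1\<close>, chains starting in \<beta> through the inverse of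
      \<open>\<phi>2\<close>. By \<open>notin\<close> these points are different.\<close>
    define \<sigma> :: "nat + nat \<Rightarrow> nat + nat" where
      "\<sigma> = case_sum (\<lambda>i. Inl (\<phi>1 i)) (\<lambda>l. if l \<in> \<phi>2 ` K2 then Inl (?i l) else Inr l)"
    show ?thesis
    proof (rule N_inj[where \<sigma> = \<sigma>])
      have nz: "l \<notin> (\<phi>2 \<circ> \<phi>1) ` K" if "g2 (Inr l) \<noteq> 0" "l \<in> \<phi>2 ` K2" for l
        using that unfolding g2_def by (simp split: if_splits)
      have nz1: "i \<in> K1" if "g2 (Inl i) \<noteq> 0" for i
        using that unfolding g2_def by (simp split: if_splits)
      have inv: "l = l'" if "l \<in> \<phi>2 ` K2" "l' \<in> \<phi>2 ` K2" "?i l = ?i l'" for l l'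
        using that ii(2) by metis
      show "inj_on \<sigma> {u. g2 u \<noteq> 0}"
      proof (rule inj_onI; clarify)
        fix u v assume u: "g2 u \<noteq> 0" and v: "g2 v \<noteq> 0" and e: "\<sigma> u = \<sigma> v"
        show "u = v"
        proof (cases u; cases v)
          fix i j assume uv: "u = Inl i" "v = Inl j"
          then show ?thesis using e u v nz1[of i] nz1[of j] inj1 by (simp add: \<sigma>_def inj_on_def)
        next
          fix i j assume uv: "u = Inl i" "v = Inr j"
          then have "j \<in> \<phi>2 ` K2" "?i j = \<phi>1 i" using e by (auto simp: \<sigma>_def split: if_splits)
          moreover have "i \<in> K1" using nz1 u uv by simp
          ultimately show ?thesis using nz[of j] v uv notin[of j] by auto
        next
          fix i j assume uv: "u = Inr i" "v = Inl j"
          then have "i \<in> \<phi>2 ` K2" "?i i = \<phi>1 j" using e by (auto simp: \<sigma>_def split: if_splits)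
          moreover have "j \<in> K1" using nz1 v uv by simp
          ultimately show ?thesis using nz[of i] u uv notin[of i] by auto
        next
          fix i j assume uv: "u = Inr i" "v = Inr j"
          then show ?thesis using e inv[of i j] by (simp add: \<sigma>_def split: if_splits)
        qed
      qed
      fix u assume u: "g2 u \<noteq> 0"
      show "g2 u \<le> mcost d \<beta> \<gamma> ?m2 (\<sigma> u)"
        by (cases u) (auto simp: g2_def \<sigma>_def)
    qed
  qed
  finally show ?thesis by (simp add: add_mono add_left_mono add_right_mono)
qed

lemma W_tri: "W \<alpha> \<gamma> \<le> W \<alpha> \<beta> + W \<beta> \<gamma>"
proof (rule ennreal_le_epsilon)
  fix e :: real assume fin: "W \<alpha> \<beta> + W \<beta> \<gamma> < top" and e: "0 < e"
  have "W \<alpha> \<beta> < W \<alpha> \<beta> + ennreal (e/2)" "W \<beta> \<gamma> < W \<beta> \<gamma> + ennreal (e/2)"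
    using fin e by (auto simp: ennreal_add_left_cancel_less[of _ 0, simplified])
  then obtain K1 \<phi>1 z1 w1 K2 \<phi>2 z2 w2
    where 1: "is_matching A \<alpha> \<beta> (K1, \<phi>1, z1, w1)" "N (mcost d \<alpha> \<beta> (K1, \<phi>1, z1, w1)) < W \<alpha> \<beta> + ennreal (e/2)"
      and 2: "is_matching A \<beta> \<gamma> (K2, \<phi>2, z2, w2)" "N (mcost d \<beta> \<gamma> (K2, \<phi>2, z2, w2)) < W \<beta> \<gamma> + ennreal (e/2)"
    by (elim W_lessE)
  have "W \<alpha> \<gamma> \<le> (W \<alpha> \<beta> + ennreal (e/2)) + (W \<beta> \<gamma> + ennreal (e/2))"
    using matching_compose[OF 1(1) 2(1)] 1(2) 2(2) by (meson add_mono less_imp_le order_trans)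
  also have "\<dots> = W \<alpha> \<beta> + W \<beta> \<gamma> + (ennreal (e/2) + ennreal (e/2))" by (simp add: ac_simps)
  also have "ennreal (e/2) + ennreal (e/2) = ennreal e" using e by (simp flip: ennreal_plus)
  finally show "W \<alpha> \<gamma> \<le> W \<alpha> \<beta> + W \<beta> \<gamma> + ennreal e" .
qed

lemma W_ext_pmetric_on: "ext_pmetric_on D W"
  by unfold_locales (auto simp: W_refl W_tri intro: W_sym)

lemma d_ext_pmetric_on: "ext_pmetric_on D d"
  by unfold_locales (auto simp: d_refl d_tri intro: d_sym)

end

lemma ennreal_add_less:
  assumes "a < ennreal r" "b < ennreal s"
  shows "a + b < ennreal (r + s)"
  using assms
  by (cases a; cases b) (auto simp: ennreal_less_iff simp flip: ennreal_plus)

lemma mem_lower_iff: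
  "i \<in> fst (lower d A \<delta> \<alpha>) \<longleftrightarrow> i \<in> fst \<alpha> \<and> dist_set d (snd \<alpha> i) A < \<delta> \<and> snd \<alpha> i \<notin> A"
  by (auto simp: lower_def restr_dgm_def thick_def)

lemma mem_upper_iff:
  "i \<in> fst (upper d A \<delta> \<alpha>) \<longleftrightarrow> i \<in> fst \<alpha> \<and> \<delta> \<le> dist_set d (snd \<alpha> i) A"
  by (auto simp: upper_def restr_dgm_def thick_def not_less)

lemma snd_lower: "snd (lower d A \<delta> \<alpha>) = snd \<alpha>"
  by (simp add: lower_def restr_dgm_def)

lemma snd_upper: "snd (upper d A \<delta> \<alpha>) = snd \<alpha>"
  by (simp add: upper_def restr_dgm_def)

section \<open>Distance to \<open>A\<close> and the part of a diagram near \<open>A\<close>\<close>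

context diagram_norm
begin

abbreviation dA :: "'a \<Rightarrow> ennreal" where "dA x \<equiv> dist_set d x A"

lemma dA_le: "a \<in> A \<Longrightarrow> dA x \<le> d x a"
  unfolding dist_set_def by (rule INF_lower)

lemma dA_tri: "dA x \<le> d x y + dA y"
proof (rule ennreal_le_epsilon)
  fix e :: real assume fin: "d x y + dA y < top" and e: "0 < e"
  have "dA y < dA y + ennreal e"
    using fin e by (auto simp: ennreal_add_left_cancel_less[of _ 0, simplified])
  then obtain a where a: "a \<in> A" "d y a < dA y + ennreal e"
    unfolding dist_set_def INF_less_iff by auto
  have "dA x \<le> d x a" by (rule dA_le[OF a(1)])
  also have "\<dots> \<le> d x y + d y a" by (rule d_tri)
  also have "\<dots> \<le> d x y + (dA y + ennreal e)" using a(2) by (intro add_left_mono) simp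
  finally show "dA x \<le> d x y + dA y + ennreal e" by (simp add: ac_simps)
qed

text \<open>Here closedness of \<open>A\<close> enters: a ball around \<open>x\<close> misses
  \<open>A\<close>. Thus every point of a diagram lies in some shell of positive distance.\<close>

lemma dA_pos:
  assumes "x \<notin> A" shows "0 < dA x"
proof -
  interpret d: ext_pmetric_on UNIV d by (rule d_ext_pmetric_on)
  have "closedin (ball_topology UNIV d) A" using mp unfolding metric_pair_def by simp
  then have "openin (ball_topology UNIV d) (UNIV - A)"
    unfolding closedin_def d.topspace_ball_topology by simp
  then obtain e where e: "0 < e" "\<forall>y. d x y < e \<longrightarrow> y \<notin> A"
    using assms unfolding openin_ball_topology ball_open_def by auto
  have "e \<le> dA x" unfolding dist_set_def using e(2) by (intro INF_greatest) (meson not_less)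
  then show ?thesis using e(1) by (rule less_le_trans[rotated])
qed

text \<open>The distance to \<open>A\<close> need not be attained, whence the factor 2.\<close>

lemma near_point:
  assumes "x \<notin> A" "dA x < top"
  obtains a where "a \<in> A" "d x a \<le> dA x + dA x"
proof -
  have "dA x < dA x + dA x"
    using assms dA_pos[of x] by (auto simp: ennreal_add_left_cancel_less[of _ 0, simplified])
  then obtain a where "a \<in> A" "d x a < dA x + dA x"
    unfolding dist_set_def[of d x A] INF_less_iff by auto
  then show ?thesis using that by simp
qed

text \<open>A substitute, free of matchings, for the distance from the lower part to the empty
  diagram: its norm agrees with that distance up to a factor 2, and it can be compared index by
  index with \<open>mcost\<close>.\<close>

definition low :: "ennreal \<Rightarrow> 'a dgm \<Rightarrow> nat + nat \<Rightarrow> ennreal" where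
  "low \<delta> \<alpha> = case_sum (\<lambda>i. if i \<in> fst \<alpha> \<and> dA (snd \<alpha> i) < \<delta> then dA (snd \<alpha> i) else 0) (\<lambda>_. 0)"

lemma low_simps:
  "low \<delta> \<alpha> (Inl i) = (if i \<in> fst \<alpha> \<and> dA (snd \<alpha> i) < \<delta> then dA (snd \<alpha> i) else 0)"
  "low \<delta> \<alpha> (Inr i) = 0"
  by (simp_all add: low_def)

text \<open>A matching with the empty diagram pairs nothing, so every point goes to \<open>A\<close>
  and pays at least its distance to \<open>A\<close>.\<close>

lemma N_low_le_W:
  assumes "\<alpha> \<in> Dbar A" shows "N (low \<delta> \<alpha>) \<le> W (lower d A \<delta> \<alpha>) zero_dgm"
  unfolding W_def
proof (rule INF_greatest, clarify)
  fix K \<phi> z w assume m: "is_matching A (lower d A \<delta> \<alpha>) zero_dgm (K, \<phi>, z, w)"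
  then have K: "K = {}" and z: "\<And>i. i \<in> fst (lower d A \<delta> \<alpha>) \<Longrightarrow> z i \<in> A"
    unfolding is_matching_def zero_dgm_def by auto
  have out: "snd \<alpha> i \<notin> A" if "i \<in> fst \<alpha>" for i using assms that unfolding Dbar_def by auto
  show "N (low \<delta> \<alpha>) \<le> N (mcost d (lower d A \<delta> \<alpha>) zero_dgm (K, \<phi>, z, w))"
  proof (rule N_mono)
    fix u show "low \<delta> \<alpha> u \<le> mcost d (lower d A \<delta> \<alpha>) zero_dgm (K, \<phi>, z, w) u"
      using z out by (cases u) (auto simp: low_simps mcost_simps K snd_lower mem_lower_iff intro!: dA_le)
  qed
qed

lemma W_le_N_low:
  assumes "\<alpha> \<in> Dbar A" shows "W (lower d A \<delta> \<alpha>) zero_dgm \<le> N (low \<delta> \<alpha>) + N (low \<delta> \<alpha>)"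
proof -
  have "\<exists>a. a \<in> A \<and> d (snd \<alpha> i) a \<le> dA (snd \<alpha> i) + dA (snd \<alpha> i)" if "i \<in> fst (lower d A \<delta> \<alpha>)" for i
  proof -
    have "snd \<alpha> i \<notin> A" "dA (snd \<alpha> i) < top" using that unfolding mem_lower_iff
      by (auto intro: less_le_trans)
    then show ?thesis using near_point by blast
  qed
  then obtain z where z: "\<And>i. i \<in> fst (lower d A \<delta> \<alpha>) \<Longrightarrow> z i \<in> A"
    "\<And>i. i \<in> fst (lower d A \<delta> \<alpha>) \<Longrightarrow> d (snd \<alpha> i) (z i) \<le> dA (snd \<alpha> i) + dA (snd \<alpha> i)" by metis
  let ?m = "({}, id, z, \<lambda>_. undefined)"
  have "is_matching A (lower d A \<delta> \<alpha>) zero_dgm ?m"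
    unfolding is_matching_def zero_dgm_def using z by auto
  then have "W (lower d A \<delta> \<alpha>) zero_dgm \<le> N (mcost d (lower d A \<delta> \<alpha>) zero_dgm ?m)" by (rule W_le)
  also have "\<dots> \<le> N (\<lambda>u. low \<delta> \<alpha> u + low \<delta> \<alpha> u)"
  proof (rule N_mono)
    fix u show "mcost d (lower d A \<delta> \<alpha>) zero_dgm ?m u \<le> low \<delta> \<alpha> u + low \<delta> \<alpha> u"
    proof (cases u)
      case (Inl i)
      then show ?thesis using z(2)[of i] by (auto simp: low_simps mcost_simps snd_lower mem_lower_iff)
    next
      case (Inr j)
      then show ?thesis by (simp add: mcost_simps zero_dgm_def)
    qed
  qed
  also have "\<dots> \<le> N (low \<delta> \<alpha>) + N (low \<delta> \<alpha>)" by (rule N_add)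
  finally show ?thesis .
qed

definition DN :: "'a dgm set" where
  "DN = {\<alpha> \<in> Dbar A. (\<forall>\<delta>::real. 0 < \<delta> \<longrightarrow> finite (fst (upper d A (ennreal \<delta>) \<alpha>))) \<and>
     (\<forall>\<epsilon>::real. 0 < \<epsilon> \<longrightarrow> (\<exists>\<delta>::real. 0 < \<delta> \<and> N (low (ennreal \<delta>) \<alpha>) < ennreal \<epsilon>))}"

text \<open>By \<open>N_point\<close> each single distance is below \<open>c\<close>, whereas an
  unmatched point of \<beta> would pay at least \<open>c\<close> to reach \<open>A\<close>.\<close>

lemma matching_partner:
  assumes m: "is_matching A \<alpha> \<beta> (K, \<phi>, z, w)" and c: "N (mcost d \<alpha> \<beta> (K, \<phi>, z, w)) < c"
    and j: "j \<in> fst \<beta>" "c \<le> dA (snd \<beta> j)"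
  obtains i where "i \<in> K" "i \<in> fst \<alpha>" "j = \<phi> i" "d (snd \<alpha> i) (snd \<beta> j) < c"
proof -
  have less: "mcost d \<alpha> \<beta> (K, \<phi>, z, w) u < c" for u
    using N_point c by (rule le_less_trans)
  have "j \<in> \<phi> ` K"
  proof (rule ccontr)
    assume "j \<notin> \<phi> ` K"
    then have "w j \<in> A" "d (w j) (snd \<beta> j) < c"
      using m j(1) less[of "Inr j"] by (auto simp: is_matching_def mcost_simps)
    then have "dA (snd \<beta> j) < c" using dA_le d_sym by (metis le_less_trans)
    then show False using j(2) by simp
  qed
  then obtain i where i: "i \<in> K" "j = \<phi> i" by blast
  then have "i \<in> fst \<alpha>" using m unfolding is_matching_def by auto
  then show ?thesis using that[of i] i less[of "Inl i"] by (simp add: mcost_simps)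
qed

lemma upper_partner:
  fixes \<epsilon> :: real
  assumes m: "is_matching A \<alpha> \<beta> (K, \<phi>, z, w)" and c: "N (mcost d \<alpha> \<beta> (K, \<phi>, z, w)) < c"
    and c2: "c \<le> ennreal (\<epsilon>/2)" and \<epsilon>: "0 < \<epsilon>" and j: "j \<in> fst (upper d A (ennreal \<epsilon>) \<beta>)"
  obtains i where "i \<in> K" "i \<in> fst (upper d A (ennreal (\<epsilon>/2)) \<alpha>)" "j = \<phi> i" "d (snd \<alpha> i) (snd \<beta> j) < c"
proof -
  have j1: "j \<in> fst \<beta>" and j2: "ennreal \<epsilon> \<le> dA (snd \<beta> j)" using j unfolding mem_upper_iff by auto
  have "ennreal (\<epsilon>/2) \<le> ennreal \<epsilon>" using \<epsilon> by (intro ennreal_leI) simp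
  then have "c \<le> dA (snd \<beta> j)" using c2 j2 by (meson order_trans)
  then obtain i where i: "i \<in> K" "i \<in> fst \<alpha>" "j = \<phi> i" "d (snd \<alpha> i) (snd \<beta> j) < c"
    using matching_partner[OF m c j1] by blast
  have "ennreal (\<epsilon>/2) \<le> dA (snd \<alpha> i)"
  proof (rule ccontr)
    assume "\<not> ?thesis"
    moreover have "d (snd \<beta> j) (snd \<alpha> i) < ennreal (\<epsilon>/2)" using i(4) c2 d_sym by (metis less_le_trans)
    ultimately have "d (snd \<beta> j) (snd \<alpha> i) + dA (snd \<alpha> i) < ennreal (\<epsilon>/2 + \<epsilon>/2)"
      by (intro ennreal_add_less) auto
    then show False using j2 dA_tri[of "snd \<beta> j" "snd \<alpha> i"] by simp
  qed
  then show ?thesis using that i by (simp add: mem_upper_iff)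
qed

lemma card_upper_le:
  fixes \<epsilon> :: real
  assumes W: "W \<alpha> \<beta> < ennreal (\<epsilon>/2)" and \<epsilon>: "0 < \<epsilon>" and fin: "finite (fst (upper d A (ennreal (\<epsilon>/2)) \<alpha>))"
  shows "card (fst (upper d A (ennreal \<epsilon>) \<beta>)) \<le> card (fst (upper d A (ennreal (\<epsilon>/2)) \<alpha>))"
proof -
  obtain K \<phi> z w where m: "is_matching A \<alpha> \<beta> (K, \<phi>, z, w)"
    "N (mcost d \<alpha> \<beta> (K, \<phi>, z, w)) < ennreal (\<epsilon>/2)"
    using W by (rule W_lessE)
  have "fst (upper d A (ennreal \<epsilon>) \<beta>) \<subseteq> \<phi> ` fst (upper d A (ennreal (\<epsilon>/2)) \<alpha>)"
    using upper_partner[OF m order_refl \<epsilon>] by blast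
  then show ?thesis using fin by (rule surj_card_le[rotated])
qed

lemma N_low_transfer:
  fixes \<delta> \<delta>' :: real
  assumes m: "is_matching A \<alpha> \<beta> (K, \<phi>, z, w)" and \<delta>: "0 < \<delta>" "2 * \<delta> \<le> \<delta>'"
  shows "N (low (ennreal \<delta>) \<beta>) \<le> N (mcost d \<alpha> \<beta> (K, \<phi>, z, w)) + N (low (ennreal \<delta>') \<alpha>)"
proof -
  let ?m = "(K, \<phi>, z, w)" and ?i = "inv_into K \<phi>"
  have inj: "inj_on \<phi> K" and K: "K \<subseteq> fst \<alpha>" and w: "\<And>j. j \<in> fst \<beta> - \<phi> ` K \<Longrightarrow> w j \<in> A"
    using m unfolding is_matching_def by auto
  have ii: "?i j \<in> K" "\<phi> (?i j) = j" "?i j \<in> fst \<alpha>" if "j \<in> \<phi> ` K" for j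
    using K inv_into_into[OF that] f_inv_into_f[OF that] by auto
  have inv: "j = k" if "j \<in> \<phi> ` K" "k \<in> \<phi> ` K" "?i j = ?i k" for j k
    using that ii(2) by metis
  \<comment> \<open>Both families are indexed by the points of \<beta>: \<open>g1\<close> is what
    the matching pays at the point, \<open>g2\<close> the distance to \<open>A\<close> of its
    partner. If the partner is too far from \<open>A\<close> to be counted in \<open>g2\<close>,
    then \<open>g1\<close> alone suffices.\<close>
  define g1 :: "nat + nat \<Rightarrow> ennreal" where "g1 = case_sum (\<lambda>j. if j \<in> fst \<beta> then if j \<in> \<phi> ` K then mcost d \<alpha> \<beta> ?m (Inl (?i j)) else mcost d \<alpha> \<beta> ?m (Inr j) else 0) (\<lambda>_. 0)"
  define g2 :: "nat + nat \<Rightarrow> ennreal" where "g2 = case_sum (\<lambda>j. if j \<in> \<phi> ` K then low (ennreal \<delta>') \<alpha> (Inl (?i j)) else 0) (\<lambda>_. 0)"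
  have "N (low (ennreal \<delta>) \<beta>) \<le> N (\<lambda>u. g1 u + g2 u)"
  proof (rule N_mono)
    fix u show "low (ennreal \<delta>) \<beta> u \<le> g1 u + g2 u"
    proof (cases "\<exists>j. u = Inl j \<and> j \<in> fst \<beta> \<and> dA (snd \<beta> j) < ennreal \<delta>")
      case False
      then have "low (ennreal \<delta>) \<beta> u = 0" by (cases u) (auto simp: low_simps)
      then show ?thesis by simp
    next
      case True
      then obtain j where u: "u = Inl j" and j: "j \<in> fst \<beta>" and low: "dA (snd \<beta> j) < ennreal \<delta>" by blast
      show ?thesis
      proof (cases "j \<in> \<phi> ` K")
        case False
        then show ?thesis using j low w[of j] dA_le[of "w j" "snd \<beta> j"]
          by (simp add: u low_simps g1_def mcost_simps d_sym[of _ "snd \<beta> j"] add_increasing2)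
      next
        case jK: True
        let ?x = "snd \<alpha> (?i j)" and ?y = "snd \<beta> j"
        have g1: "g1 u = d ?x ?y" using jK j ii[OF jK] by (simp add: u g1_def mcost_simps)
        show ?thesis
        proof (cases "dA ?x < ennreal \<delta>'")
          case True
          then have "g2 u = dA ?x" using jK ii[OF jK] by (simp add: u g2_def low_simps)
          then show ?thesis using j low g1 dA_tri[of ?y ?x] by (simp add: u low_simps d_sym[of ?y])
        next
          case False
          have "ennreal \<delta> \<le> d ?x ?y"
          proof (rule ccontr)
            assume "\<not> ?thesis"
            then have "d ?x ?y + dA ?y < ennreal (\<delta> + \<delta>)" using low by (intro ennreal_add_less) auto
            also have "\<dots> \<le> ennreal \<delta>'" using \<delta> by (intro ennreal_leI) simp
            finally show False using False dA_tri[of ?x ?y] by (simp add: le_less_trans)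
          qed
          then have "dA ?y \<le> g1 u" using low g1 by simp
          then show ?thesis using j low by (simp add: u low_simps add_increasing2)
        qed
      qed
    qed
  qed
  also have "\<dots> \<le> N g1 + N g2" by (rule N_add)
  also have "N g1 \<le> N (mcost d \<alpha> \<beta> ?m)"
  proof (rule N_inj[where \<sigma> = "case_sum (\<lambda>j. if j \<in> \<phi> ` K then Inl (?i j) else Inr j) Inr"])
    fix u show "g1 u \<le> mcost d \<alpha> \<beta> ?m (case_sum (\<lambda>j. if j \<in> \<phi> ` K then Inl (?i j) else Inr j) Inr u)"
      by (cases u) (auto simp: g1_def)
  next
    show "inj_on (case_sum (\<lambda>j. if j \<in> \<phi> ` K then Inl (?i j) else Inr j) Inr) {u. g1 u \<noteq> 0}"
    proof (rule inj_onI; clarify)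
      fix u v assume u: "g1 u \<noteq> 0" and v: "g1 v \<noteq> 0"
        and e: "case_sum (\<lambda>j. if j \<in> \<phi> ` K then Inl (?i j) else Inr j) Inr u = case_sum (\<lambda>j. if j \<in> \<phi> ` K then Inl (?i j) else Inr j) Inr v"
      obtain j k where jk: "u = Inl j" "v = Inl k"
        using u v by (cases u; cases v) (auto simp: g1_def)
      show "u = v" using e inv[of j k] unfolding jk by (simp split: if_splits)
    qed
  qed
  also have "N g2 \<le> N (low (ennreal \<delta>') \<alpha>)"
  proof (rule N_inj[where \<sigma> = "map_sum ?i id"])
    fix u show "g2 u \<le> low (ennreal \<delta>') \<alpha> (map_sum ?i id u)"
      by (cases u) (auto simp: g2_def)
  next
    show "inj_on (map_sum ?i id) {u. g2 u \<noteq> 0}"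
    proof (rule inj_onI; clarify)
      fix u v assume u: "g2 u \<noteq> 0" and v: "g2 v \<noteq> 0" and e: "map_sum ?i id u = map_sum ?i id v"
      obtain j k where jk: "u = Inl j" "v = Inl k" "j \<in> \<phi> ` K" "k \<in> \<phi> ` K"
        using u v by (cases u; cases v) (auto simp: g2_def split: if_splits)
      show "u = v" using e inv[of j k] jk by simp
    qed
  qed
  finally show ?thesis by (simp add: add_mono add_left_mono add_right_mono)
qed

section \<open>Necessity of the conditions\<close>

definition N_vanishing :: "'a dgm set \<Rightarrow> bool" where
  "N_vanishing S \<longleftrightarrow> (\<forall>\<epsilon>::real. 0 < \<epsilon> \<longrightarrow>
     (\<exists>\<delta>::real. 0 < \<delta> \<and> (\<forall>\<alpha>\<in>S. N (low (ennreal \<delta>) \<alpha>) < ennreal \<epsilon>)))"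

lemma rel_compact_subseq:
  assumes "S \<subseteq> DN" "rel_compact_in (ball_topology DN W) S" "\<And>n::nat. s n \<in> S"
  obtains \<alpha> r where "\<alpha> \<in> DN" "strict_mono (r::nat \<Rightarrow> nat)" "(\<lambda>n. W \<alpha> (s (r n))) \<longlonglongrightarrow> 0"
  by (rule ext_pmetric_on.rel_compact_imp_seq[where s = s, OF W_ext_pmetric_on assms(1,2)]) (rule assms(3), rule that)

lemma rel_compact_imp_upper_finite:
  assumes S: "S \<subseteq> DN" and rc: "rel_compact_in (ball_topology DN W) S"
  shows "unif_upper_finite d A S"
proof (rule ccontr)
  assume "\<not> ?thesis"
  then obtain \<epsilon> :: real where \<epsilon>: "0 < \<epsilon>" and
    "\<forall>M::nat. \<exists>\<alpha>. \<alpha> \<in> S \<and> \<not> (finite (fst (upper d A (ennreal \<epsilon>) \<alpha>)) \<and> card (fst (upper d A (ennreal \<epsilon>) \<alpha>)) \<le> M)"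
    unfolding unif_upper_finite_def by blast
  then obtain s where s: "\<And>M::nat. s M \<in> S"
    "\<And>M. \<not> (finite (fst (upper d A (ennreal \<epsilon>) (s M))) \<and> card (fst (upper d A (ennreal \<epsilon>) (s M))) \<le> M)"
    unfolding choice_iff by blast
  have "finite (fst (upper d A (ennreal \<epsilon>) (s M)))" for M
    using s(1)[of M] S \<epsilon> unfolding DN_def by auto
  then have big: "M < card (fst (upper d A (ennreal \<epsilon>) (s M)))" for M using s(2)[of M] by simp
  obtain \<alpha> and r :: "nat \<Rightarrow> nat" where \<alpha>: "\<alpha> \<in> DN" and r: "strict_mono r" and lim: "(\<lambda>n. W \<alpha> (s (r n))) \<longlonglongrightarrow> 0"
    by (rule rel_compact_subseq[where s = s, OF S rc]) (rule s(1))
  let ?c = "card (fst (upper d A (ennreal (\<epsilon>/2)) \<alpha>))"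
  have fin: "finite (fst (upper d A (ennreal (\<epsilon>/2)) \<alpha>))" using \<alpha> \<epsilon> unfolding DN_def by simp
  \<comment> \<open>The shift forces the chosen index to be at least \<open>?c\<close>, so that
    diagram has more than \<open>?c\<close> points away from \<open>A\<close>.\<close>
  have "(\<lambda>n. W \<alpha> (s (r (n + ?c)))) \<longlonglongrightarrow> 0" using LIMSEQ_ignore_initial_segment[OF lim] .
  then obtain n where "W \<alpha> (s (r (n + ?c))) < ennreal (\<epsilon>/2)"
    by (rule tendsto_0_ex_less[of _ "ennreal (\<epsilon>/2)"]) (use \<epsilon> in \<open>auto simp: ennreal_less_zero_iff\<close>)
  then have "card (fst (upper d A (ennreal \<epsilon>) (s (r (n + ?c))))) \<le> ?c"
    using \<epsilon> fin by (rule card_upper_le)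
  moreover have "n + ?c \<le> r (n + ?c)" using r by (rule seq_suble)
  ultimately show False using big[of "r (n + ?c)"] by linarith
qed

lemma rel_compact_imp_vanishing:
  assumes S: "S \<subseteq> DN" and rc: "rel_compact_in (ball_topology DN W) S"
  shows "N_vanishing S"
proof (rule ccontr)
  assume "\<not> ?thesis"
  then obtain \<epsilon> :: real where \<epsilon>: "0 < \<epsilon>" and
    neg: "\<And>\<delta>::real. 0 < \<delta> \<Longrightarrow> \<exists>\<alpha>. \<alpha> \<in> S \<and> \<not> N (low (ennreal \<delta>) \<alpha>) < ennreal \<epsilon>"
    unfolding N_vanishing_def by blast
  have "\<forall>n. \<exists>\<alpha>. \<alpha> \<in> S \<and> \<not> N (low (ennreal (inverse (real (Suc n)))) \<alpha>) < ennreal \<epsilon>"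
    by (intro allI neg) simp
  then obtain s where s: "\<And>n::nat. s n \<in> S"
    "\<And>n. \<not> N (low (ennreal (inverse (real (Suc n)))) (s n)) < ennreal \<epsilon>"
    unfolding choice_iff by blast
  obtain \<alpha> and r :: "nat \<Rightarrow> nat" where \<alpha>: "\<alpha> \<in> DN" and r: "strict_mono r" and lim: "(\<lambda>n. W \<alpha> (s (r n))) \<longlonglongrightarrow> 0"
    by (rule rel_compact_subseq[where s = s, OF S rc]) (rule s(1))
  have "0 < \<epsilon>/2" using \<epsilon> by simp
  then obtain \<delta> :: real where \<delta>: "0 < \<delta>" "N (low (ennreal \<delta>) \<alpha>) < ennreal (\<epsilon>/2)"
    using \<alpha> unfolding DN_def by blast
  \<comment> \<open>Half of \<delta>, because \<open>N_low_transfer\<close> asks that the threshold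
    for the limit be at least twice the threshold for the violating diagram.\<close>
  obtain n0 where n0: "inverse (real (Suc n0)) < \<delta>/2" using \<delta>(1) reals_Archimedean[of "\<delta>/2"] by auto
  have "(\<lambda>n. W \<alpha> (s (r (n + n0)))) \<longlonglongrightarrow> 0" using LIMSEQ_ignore_initial_segment[OF lim] .
  then obtain n where n: "W \<alpha> (s (r (n + n0))) < ennreal (\<epsilon>/2)"
    by (rule tendsto_0_ex_less[of _ "ennreal (\<epsilon>/2)"]) (use \<epsilon> in \<open>auto simp: ennreal_less_zero_iff\<close>)
  let ?k = "r (n + n0)"
  have "n0 \<le> ?k" using seq_suble[OF r, of "n + n0"] by simp
  then have "inverse (real (Suc ?k)) \<le> inverse (real (Suc n0))" by (intro le_imp_inverse_le) auto
  then have k: "2 * inverse (real (Suc ?k)) \<le> \<delta>" using n0 by linarith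
  obtain K \<phi> z w where m: "is_matching A \<alpha> (s ?k) (K, \<phi>, z, w)"
    "N (mcost d \<alpha> (s ?k) (K, \<phi>, z, w)) < ennreal (\<epsilon>/2)"
    using n by (rule W_lessE)
  have "N (low (ennreal (inverse (real (Suc ?k)))) (s ?k))
      \<le> N (mcost d \<alpha> (s ?k) (K, \<phi>, z, w)) + N (low (ennreal \<delta>) \<alpha>)"
    by (rule N_low_transfer[OF m(1) _ k]) simp
  also have "\<dots> < ennreal (\<epsilon>/2 + \<epsilon>/2)" using m(2) \<delta>(2) by (rule ennreal_add_less)
  finally show False using s(2)[of ?k] by simp
qed

lemma rel_compact_imp_upper_rel_compact:
  assumes S: "S \<subseteq> DN" and rc: "rel_compact_in (ball_topology DN W) S"
  shows "upper_rel_compact d A S"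
  unfolding upper_rel_compact_def
proof (intro allI impI)
  fix \<epsilon> :: real assume \<epsilon>: "0 < \<epsilon>"
  let ?U = "\<Union>\<alpha>\<in>S. supp (upper d A (ennreal \<epsilon>) \<alpha>)"
  show "rel_compact_in (ball_topology UNIV d) ?U"
  proof (rule ext_pmetric_on.seq_imp_rel_compact[OF d_ext_pmetric_on])
    fix x assume "\<And>n::nat. x n \<in> ?U"
    then have "\<forall>n. \<exists>\<alpha>. \<alpha> \<in> S \<and> x n \<in> supp (upper d A (ennreal \<epsilon>) \<alpha>)" by blast
    then obtain s where s: "\<And>n. s n \<in> S" "\<And>n. x n \<in> supp (upper d A (ennreal \<epsilon>) (s n))"
      unfolding choice_iff by blast
    obtain \<alpha> and r :: "nat \<Rightarrow> nat" where \<alpha>: "\<alpha> \<in> DN" and r: "strict_mono r" and lim: "(\<lambda>n. W \<alpha> (s (r n))) \<longlonglongrightarrow> 0"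
      by (rule rel_compact_subseq[where s = s, OF S rc]) (rule s(1))
    define F where "F = fst (upper d A (ennreal (\<epsilon>/2)) \<alpha>)"
    have F: "finite F" unfolding F_def using \<alpha> \<epsilon> unfolding DN_def by simp
    \<comment> \<open>Pigeonhole: eventually every \<open>x (r n)\<close> is close to one of the
      finitely many points indexed by \<open>F\<close>, so one of these is a cluster point.\<close>
    have "\<exists>i\<in>F. \<forall>e m. 0 < e \<longrightarrow> (\<exists>n\<ge>m. d (snd \<alpha> i) (x (r n)) < e)"
    proof (rule ccontr)
      assume "\<not> ?thesis"
      then have "\<forall>i. \<exists>e. i \<in> F \<longrightarrow> 0 < e \<and> (\<exists>m. \<forall>n\<ge>m. \<not> d (snd \<alpha> i) (x (r n)) < e)" by blast
      then obtain e where e: "\<And>i. i \<in> F \<Longrightarrow> 0 < e i"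
        "\<And>i. i \<in> F \<Longrightarrow> \<forall>\<^sub>F n in sequentially. \<not> d (snd \<alpha> i) (x (r n)) < e i"
        unfolding choice_iff eventually_sequentially by blast
      \<comment> \<open>Below \<epsilon>/2, so that a partner must exist in \<open>F\<close>, and
        below every \<open>e i\<close>, so that this partner contradicts the choice of
        \<open>e\<close>. With \<open>F\<close> empty, the existence of a partner is already
        absurd.\<close>
      define c where "c = Min (insert (ennreal (\<epsilon>/2)) (e ` F))"
      have c0: "0 < c" unfolding c_def using F e(1) \<epsilon> by (subst Min_gr_iff) (auto simp: ennreal_less_zero_iff)
      have c1: "c \<le> ennreal (\<epsilon>/2)" unfolding c_def using F by (intro Min_le) auto
      have c2: "c \<le> e i" if "i \<in> F" for i unfolding c_def using F that by (intro Min_le) auto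
      have "\<forall>\<^sub>F n in sequentially. W \<alpha> (s (r n)) < c" using order_tendstoD(2)[OF lim c0] .
      moreover have "\<forall>\<^sub>F n in sequentially. \<forall>i\<in>F. \<not> d (snd \<alpha> i) (x (r n)) < e i"
        using F e(2) by (intro eventually_ball_finite) auto
      ultimately have "\<forall>\<^sub>F n in sequentially. W \<alpha> (s (r n)) < c \<and> (\<forall>i\<in>F. \<not> d (snd \<alpha> i) (x (r n)) < e i)"
        by (rule eventually_conj)
      then obtain n where n: "W \<alpha> (s (r n)) < c" "\<And>i. i \<in> F \<Longrightarrow> \<not> d (snd \<alpha> i) (x (r n)) < e i"
        unfolding eventually_sequentially by blast
      obtain K \<phi> z w where m: "is_matching A \<alpha> (s (r n)) (K, \<phi>, z, w)"
        "N (mcost d \<alpha> (s (r n)) (K, \<phi>, z, w)) < c"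
        using n(1) by (rule W_lessE)
      obtain j where j: "j \<in> fst (upper d A (ennreal \<epsilon>) (s (r n)))" "x (r n) = snd (s (r n)) j"
        using s(2)[of "r n"] unfolding supp_def snd_upper by blast
      obtain i where "i \<in> F" "d (snd \<alpha> i) (x (r n)) < c"
        using upper_partner[OF m c1 \<epsilon> j(1)] j(2) unfolding F_def by metis
      then show False using n(2) c2 by (meson less_le_trans)
    qed
    then obtain i where i: "\<And>e m. 0 < e \<Longrightarrow> \<exists>n\<ge>m. d (snd \<alpha> i) (x (r n)) < e" by blast
    obtain r' :: "nat \<Rightarrow> nat" where r': "strict_mono r'" "(\<lambda>n. d (snd \<alpha> i) (x (r (r' n)))) \<longlonglongrightarrow> 0"
      using i by (rule subseq_tendsto_0)
    have "strict_mono (r \<circ> r')" using r r'(1) by (rule strict_mono_o)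
    then show "\<exists>l\<in>UNIV. \<exists>r::nat\<Rightarrow>nat. strict_mono r \<and> (\<lambda>n. d l (x (r n))) \<longlonglongrightarrow> 0"
      using r'(2) by (intro bexI[of _ "snd \<alpha> i"] exI[of _ "r \<circ> r'"]) auto
  qed simp
qed

end

text \<open>The tolerance is spread evenly over \<open>F\<close>; the added 1 keeps the denominator
  positive for empty \<open>F\<close>.\<close>

lemma (in cost_norm) N_finite_le:
  fixes \<eta> :: real
  assumes F: "finite F" and \<eta>: "0 \<le> \<eta>"
    and g: "\<And>i. i \<in> F \<Longrightarrow> g i \<le> ennreal (\<eta> / (real (card F) + 1))" "\<And>i. i \<notin> F \<Longrightarrow> g i = 0"
  shows "N g \<le> ennreal \<eta>"
proof -
  have "N g \<le> of_nat (card F) * ennreal (\<eta> / (real (card F) + 1))" using F g by (rule N_finite)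
  also have "\<dots> = ennreal (real (card F) * (\<eta> / (real (card F) + 1)))"
    using \<eta> by (simp add: ennreal_of_nat_eq_real_of_nat ennreal_mult[symmetric])
  also have "\<dots> \<le> ennreal \<eta>"
    using \<eta> by (intro ennreal_leI) (simp add: field_simps)
  finally show ?thesis .
qed

section \<open>The limit of a sequence of diagrams with common names for their points\<close>

context diagram_norm
begin

text \<open>\<open>e n i\<close> is the name of the point \<open>i\<close> of \<open>t n\<close>.
  All points at distance at least 1/(k+1) from \<open>A\<close>, in every \<open>t n\<close>, have
  names in the finite set \<open>H k\<close>. The names in \<open>J\<close> survive, with limit
  points \<open>l j\<close>; under any other name the points approach \<open>A\<close> or are
  absent.\<close>

context
  fixes t :: "nat \<Rightarrow> 'a dgm" and e :: "nat \<Rightarrow> nat \<Rightarrow> nat" and H :: "nat \<Rightarrow> nat set"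
    and J :: "nat set" and l :: "nat \<Rightarrow> 'a"
  assumes t: "\<And>n. t n \<in> Dbar A"
    and inj: "\<And>n. inj_on (e n) (fst (t n))"
    and H: "\<And>k. finite (H k)"
    and eH: "\<And>n k i. i \<in> fst (t n) \<Longrightarrow> ennreal (inverse (real (Suc k))) \<le> dA (snd (t n) i) \<Longrightarrow> e n i \<in> H k"
    and J: "\<And>j. j \<in> J \<Longrightarrow> l j \<notin> A"
    and conv: "\<And>j c. j \<in> J \<Longrightarrow> 0 < c \<Longrightarrow> \<forall>\<^sub>F n in sequentially. \<exists>i\<in>fst (t n). e n i = j \<and> d (l j) (snd (t n) i) < c"
    and van: "\<And>j c. j \<notin> J \<Longrightarrow> 0 < c \<Longrightarrow> \<forall>\<^sub>F n in sequentially. \<forall>i\<in>fst (t n). e n i = j \<longrightarrow> dA (snd (t n) i) < c"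
    and V: "\<And>\<epsilon>::real. 0 < \<epsilon> \<Longrightarrow> \<exists>\<delta>::real. 0 < \<delta> \<and> (\<forall>n. N (low (ennreal \<delta>) (t n)) < ennreal \<epsilon>)"
begin

lemma outside_H: "i \<in> fst (t n) \<Longrightarrow> e n i \<notin> H k \<Longrightarrow> dA (snd (t n) i) < ennreal (inverse (real (Suc k)))"
  using eH[of i n k] by (meson not_less)

text \<open>A name outside \<open>H k\<close> is only ever carried by points within 1/(k+1) of
  \<open>A\<close>, and this bound passes to the limit point, losing strictness.\<close>

lemma limit_tail_small:
  assumes j: "j \<in> J" "j \<notin> H k"
  shows "dA (l j) \<le> ennreal (inverse (real (Suc k)))"
proof (rule ennreal_le_epsilon)
  fix c :: real assume c: "0 < c"
  then have "0 < ennreal c" by (simp add: ennreal_less_zero_iff)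
  then obtain n i where i: "i \<in> fst (t n)" "e n i = j" "d (l j) (snd (t n) i) < ennreal c"
    using conv[OF j(1)] unfolding eventually_sequentially by blast
  have "dA (l j) \<le> d (l j) (snd (t n) i) + dA (snd (t n) i)" by (rule dA_tri)
  also have "\<dots> \<le> ennreal c + ennreal (inverse (real (Suc k)))"
    using i outside_H[of i n k] j(2) by (intro add_mono) auto
  finally show "dA (l j) \<le> ennreal (inverse (real (Suc k))) + ennreal c" by (simp add: add.commute)
qed

text \<open>The limit diagram is cut by names and not by distance to \<open>A\<close>, so that the
  same cut applies to the approximating diagrams.\<close>

definition tail :: "nat \<Rightarrow> nat + nat \<Rightarrow> ennreal" where
  "tail k = case_sum (\<lambda>j. if j \<in> J \<and> j \<notin> H k then dA (l j) else 0) (\<lambda>_. 0)"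

text \<open>Fatou reduces the claim to finitely many names. For these a single \<open>t n\<close> is
  close to the limit at all names simultaneously, and its points with these names lie within
  \<delta> of \<open>A\<close>, hence are counted in \<open>low\<close>.\<close>

lemma N_tail_le:
  assumes k: "inverse (real (Suc k)) \<le> \<delta>" and c: "\<And>n. N (low (ennreal \<delta>) (t n)) \<le> c"
  shows "N (tail k) \<le> c"
proof (rule N_Fatou)
  fix F :: "(nat + nat) set" assume F: "finite F"
  define G where "G = {j. Inl j \<in> F \<and> j \<in> J \<and> j \<notin> H k}"
  have G: "finite G"
    by (rule finite_subset[of _ "projl ` F"]) (use F in \<open>force simp: G_def image_iff\<close>)+
  show "N (\<lambda>i. if i \<in> F then tail k i else 0) \<le> c"
  proof (rule ennreal_le_epsilon)
    fix \<eta> :: real assume \<eta>: "0 < \<eta>"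
    define \<theta> where "\<theta> = \<eta> / (real (card G) + 1)"
    have \<theta>: "0 < \<theta>" unfolding \<theta>_def using \<eta> by (intro divide_pos_pos) auto
    have "\<forall>\<^sub>F n in sequentially. \<forall>j\<in>G. \<exists>i\<in>fst (t n). e n i = j \<and> d (l j) (snd (t n) i) < ennreal \<theta>"
      using G \<theta> by (intro eventually_ball_finite ballI conv) (auto simp: G_def ennreal_less_zero_iff)
    then obtain n where "\<forall>j\<in>G. \<exists>i\<in>fst (t n). e n i = j \<and> d (l j) (snd (t n) i) < ennreal \<theta>"
      unfolding eventually_sequentially by blast
    then obtain \<iota> where \<iota>: "\<And>j. j \<in> G \<Longrightarrow> \<iota> j \<in> fst (t n)" "\<And>j. j \<in> G \<Longrightarrow> e n (\<iota> j) = j"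
      "\<And>j. j \<in> G \<Longrightarrow> d (l j) (snd (t n) (\<iota> j)) < ennreal \<theta>" by metis
    define p :: "nat + nat \<Rightarrow> ennreal" where
      "p = case_sum (\<lambda>j. if j \<in> G then dA (snd (t n) (\<iota> j)) else 0) (\<lambda>_. 0)"
    define q :: "nat + nat \<Rightarrow> ennreal" where
      "q = case_sum (\<lambda>j. if j \<in> G then ennreal \<theta> else 0) (\<lambda>_. 0)"
    have "N (\<lambda>i. if i \<in> F then tail k i else 0) \<le> N (\<lambda>u. p u + q u)"
    proof (rule N_mono)
      fix u show "(if u \<in> F then tail k u else 0) \<le> p u + q u"
      proof (cases "\<exists>j\<in>G. u = Inl j")
        case True
        then obtain j where j: "j \<in> G" "u = Inl j" by blast
        have "dA (l j) \<le> d (l j) (snd (t n) (\<iota> j)) + dA (snd (t n) (\<iota> j))" by (rule dA_tri)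
        also have "\<dots> \<le> ennreal \<theta> + dA (snd (t n) (\<iota> j))" using \<iota>(3)[OF j(1)] by (intro add_right_mono) simp
        finally show ?thesis using j by (simp add: p_def q_def tail_def G_def add.commute)
      next
        case False
        then have "u \<in> F \<Longrightarrow> tail k u = 0" by (cases u) (auto simp: tail_def G_def)
        then show ?thesis by simp
      qed
    qed
    also have "\<dots> \<le> N p + N q" by (rule N_add)
    also have "N p \<le> N (low (ennreal \<delta>) (t n))"
    proof (rule N_inj[where \<sigma> = "map_sum \<iota> id"])
      show "inj_on (map_sum \<iota> id) {u. p u \<noteq> 0}"
      proof (rule inj_onI; clarify)
        fix u v assume u: "p u \<noteq> 0" and v: "p v \<noteq> 0" and eq: "map_sum \<iota> id u = map_sum \<iota> id v"
        obtain j j' where jj: "u = Inl j" "v = Inl j'" "j \<in> G" "j' \<in> G"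
          using u v by (cases u; cases v) (auto simp: p_def split: if_splits)
        then have "\<iota> j = \<iota> j'" using eq by simp
        then show "u = v" using \<iota>(2) jj by metis
      qed
      fix u assume "p u \<noteq> 0"
      then obtain j where j: "u = Inl j" "j \<in> G"
        by (cases u) (auto simp: p_def split: if_splits)
      have "dA (snd (t n) (\<iota> j)) < ennreal (inverse (real (Suc k)))"
        using \<iota>[OF j(2)] j(2) by (intro outside_H) (auto simp: G_def)
      also have "\<dots> \<le> ennreal \<delta>" using k by (rule ennreal_leI)
      finally show "p u \<le> low (ennreal \<delta>) (t n) (map_sum \<iota> id u)"
        using j \<iota>(1) by (simp add: p_def low_simps)
    qed
    also have "\<dots> \<le> c" by (rule c)
    also have "N q \<le> ennreal \<eta>"
      using G by (intro N_finite_le[where F = "Inl ` G"])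
        (use \<eta> in \<open>auto simp: q_def \<theta>_def card_image split: sum.splits\<close>)
    finally show "N (\<lambda>i. if i \<in> F then tail k i else 0) \<le> c + ennreal \<eta>"
      by (simp add: add_mono add_left_mono add_right_mono)
  qed
qed

lemma small_tail:
  fixes \<epsilon> :: real assumes "0 < \<epsilon>"
  obtains \<delta> :: real and k where "0 < \<delta>" "inverse (real (Suc k)) \<le> \<delta>"
    "\<And>n. N (low (ennreal \<delta>) (t n)) \<le> ennreal \<epsilon>" "N (tail k) \<le> ennreal \<epsilon>"
proof -
  obtain \<delta> :: real where \<delta>: "0 < \<delta>" "\<And>n. N (low (ennreal \<delta>) (t n)) \<le> ennreal \<epsilon>"
    using V[OF assms] by (auto intro: less_imp_le)
  obtain k where k: "inverse (real (Suc k)) \<le> \<delta>"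
    using reals_Archimedean[OF \<delta>(1)] by (auto intro: less_imp_le)
  show ?thesis using that[OF \<delta>(1) k \<delta>(2)] N_tail_le[OF k \<delta>(2)] by simp
qed

lemma limit_in_DN: "(J, l) \<in> DN"
  unfolding DN_def
proof (intro CollectI conjI allI impI)
  show "(J, l) \<in> Dbar A" unfolding Dbar_def using J by simp
next
  fix \<delta> :: real assume \<delta>: "0 < \<delta>"
  obtain k where k: "inverse (real (Suc k)) < \<delta>" using reals_Archimedean[OF \<delta>] by blast
  have "fst (upper d A (ennreal \<delta>) (J, l)) \<subseteq> H k"
  proof
    fix j assume "j \<in> fst (upper d A (ennreal \<delta>) (J, l))"
    then have j: "j \<in> J" "ennreal \<delta> \<le> dA (l j)" by (auto simp: mem_upper_iff)
    show "j \<in> H k"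
    proof (rule ccontr)
      assume "j \<notin> H k"
      then have "ennreal \<delta> \<le> ennreal (inverse (real (Suc k)))"
        using limit_tail_small[OF j(1)] j(2) by (meson order_trans)
      then show False using k \<delta> by (simp add: ennreal_le_iff del: of_nat_Suc)
    qed
  qed
  then show "finite (fst (upper d A (ennreal \<delta>) (J, l)))" using H by (rule finite_subset)
next
  fix \<epsilon> :: real assume \<epsilon>: "0 < \<epsilon>"
  then have "0 < \<epsilon>/2" by simp
  then obtain k where tail: "N (tail k) \<le> ennreal (\<epsilon>/2)"
    using small_tail by metis
  \<comment> \<open>Below this distance no limit point with a name in \<open>H k\<close> is left, so
    only \<open>tail k\<close> contributes; \<open>1\<close> covers the empty case.\<close>
  define c where "c = Min (insert 1 ((\<lambda>j. dA (l j)) ` (J \<inter> H k)))"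
  have fin: "finite (J \<inter> H k)" using H by simp
  have "0 < c" unfolding c_def using fin dA_pos J by (subst Min_gr_iff) auto
  then obtain r :: real where r: "0 < r" "ennreal r \<le> c" by (rule ennreal_pos_real_below)
  have "c \<le> dA (l j)" if "j \<in> J" "j \<in> H k" for j
    unfolding c_def using fin that by (intro Min_le) auto
  then have far: "\<not> dA (l j) < ennreal r" if "j \<in> J" "j \<in> H k" for j
    using that r(2) by (meson not_less order_trans)
  have "N (low (ennreal r) (J, l)) \<le> N (tail k)"
  proof (rule N_mono)
    fix u show "low (ennreal r) (J, l) u \<le> tail k u"
      using far by (cases u) (auto simp: low_simps tail_def)
  qed
  also note tail
  also have "ennreal (\<epsilon>/2) < ennreal \<epsilon>" using \<epsilon> by (simp add: ennreal_less_iff)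
  finally show "\<exists>\<delta>::real. 0 < \<delta> \<and> N (low (ennreal \<delta>) (J, l)) < ennreal \<epsilon>"
    using r(1) by blast
qed

text \<open>The factor 6 is 2 + 2 + 2: the names in \<open>H k\<close> (at most twice \<eta> each),
  the other points of \<open>t n\<close>, and the limit points with names outside
  \<open>H k\<close>. The last two groups go to \<open>A\<close> at twice their distance.\<close>

lemma limit_matching:
  fixes \<epsilon> \<eta> \<delta> :: real
  assumes k: "inverse (real (Suc k)) \<le> \<delta>"
    and low: "N (low (ennreal \<delta>) (t n)) \<le> ennreal \<epsilon>" and tail: "N (tail k) \<le> ennreal \<epsilon>"
    and \<epsilon>: "0 < \<epsilon>" and \<eta>: "\<eta> = \<epsilon> / (real (card (H k)) + 1)"
    and near: "\<And>j. j \<in> H k \<Longrightarrow> j \<in> J \<Longrightarrow> \<exists>i\<in>fst (t n). e n i = j \<and> d (l j) (snd (t n) i) < ennreal \<eta>"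
    and vanish: "\<And>j i. j \<in> H k \<Longrightarrow> j \<notin> J \<Longrightarrow> i \<in> fst (t n) \<Longrightarrow> e n i = j \<Longrightarrow> dA (snd (t n) i) < ennreal \<eta>"
  shows "W (J, l) (t n) \<le> ennreal (6 * \<epsilon>)"
proof -
  have \<eta>0: "0 < \<eta>" unfolding \<eta> using \<epsilon> by (intro divide_pos_pos) auto
  define K where "K = {i \<in> fst (t n). e n i \<in> J \<and> e n i \<in> H k}"
  have Kd: "d (snd (t n) i) (l (e n i)) < ennreal \<eta>" if i: "i \<in> K" for i
  proof -
    obtain i' where "i' \<in> fst (t n)" "e n i' = e n i" "d (l (e n i)) (snd (t n) i') < ennreal \<eta>"
      using near[of "e n i"] i unfolding K_def by auto
    \<comment> \<open>\<open>near\<close> only yields some point with the right name; names are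
      injective, so it is the given one.\<close>
    moreover have "i' = i" using inj[of n] calculation i unfolding K_def inj_on_def by auto
    ultimately show ?thesis using d_sym by metis
  qed
  have hit: "j \<in> e n ` K" if j: "j \<in> J" "j \<in> H k" for j
    using near[OF j(2,1)] j unfolding K_def by blast
  have out: "snd (t n) i \<notin> A" if "i \<in> fst (t n)" for i
    using t[of n] that unfolding Dbar_def by auto
  have "\<forall>i. \<exists>a. i \<in> fst (t n) - K \<longrightarrow> a \<in> A \<and> d (snd (t n) i) a \<le> dA (snd (t n) i) + dA (snd (t n) i)"
  proof
    fix i
    \<comment> \<open>\<open>near_point\<close> needs a finite distance to \<open>A\<close>. Outside
      \<open>K\<close> it is below \<eta> or below 1/(k+1); points infinitely far from
      \<open>A\<close> are all matched.\<close>
    have "dA (snd (t n) i) < top" if i: "i \<in> fst (t n) - K"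
    proof (cases "e n i \<in> H k")
      case True
      then show ?thesis using vanish[of "e n i" i] i unfolding K_def by (auto intro: less_le_trans)
    next
      case False
      then show ?thesis using outside_H[of i n k] i by (auto intro: less_le_trans)
    qed
    then show "\<exists>a. i \<in> fst (t n) - K \<longrightarrow> a \<in> A \<and> d (snd (t n) i) a \<le> dA (snd (t n) i) + dA (snd (t n) i)"
      using near_point[of "snd (t n) i"] out[of i] by (metis DiffD1)
  qed
  then obtain z where z: "\<And>i. i \<in> fst (t n) - K \<Longrightarrow> z i \<in> A"
    "\<And>i. i \<in> fst (t n) - K \<Longrightarrow> d (snd (t n) i) (z i) \<le> dA (snd (t n) i) + dA (snd (t n) i)"
    unfolding choice_iff by blast
  have "\<forall>j. \<exists>a. j \<in> J \<and> j \<notin> H k \<longrightarrow> a \<in> A \<and> d (l j) a \<le> dA (l j) + dA (l j)"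
  proof
    fix j
    have "dA (l j) < top" if "j \<in> J" "j \<notin> H k"
      using limit_tail_small[OF that] by (rule le_less_trans) simp
    then show "\<exists>a. j \<in> J \<and> j \<notin> H k \<longrightarrow> a \<in> A \<and> d (l j) a \<le> dA (l j) + dA (l j)"
      using near_point[of "l j"] J[of j] by metis
  qed
  then obtain w where w: "\<And>j. j \<in> J \<Longrightarrow> j \<notin> H k \<Longrightarrow> w j \<in> A"
    "\<And>j. j \<in> J \<Longrightarrow> j \<notin> H k \<Longrightarrow> d (l j) (w j) \<le> dA (l j) + dA (l j)"
    unfolding choice_iff by blast
  let ?m = "(K, e n, z, w)"
  have m: "is_matching A (t n) (J, l) ?m"
    unfolding is_matching_def prod.case
  proof (intro conjI ballI)
    show "K \<subseteq> fst (t n)" "e n ` K \<subseteq> fst (J, l)" unfolding K_def by auto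
    show "inj_on (e n) K" by (rule inj_on_subset[OF inj]) (auto simp: K_def)
    show "z i \<in> A" if "i \<in> fst (t n) - K" for i using z(1)[OF that] .
    show "w j \<in> A" if "j \<in> fst (J, l) - e n ` K" for j using w(1)[of j] hit[of j] that by auto
  qed
  define p where "p = case_sum (\<lambda>i. if i \<in> fst (t n) \<and> e n i \<in> H k then ennreal (2 * \<eta>) else 0) (\<lambda>_::nat. 0)"
  define q where "q = case_sum (\<lambda>_::nat. 0) (\<lambda>j. if j \<in> J \<and> j \<notin> H k then dA (l j) else 0)"
  have \<eta>\<eta>: "ennreal \<eta> + ennreal \<eta> = ennreal (2 * \<eta>)" using \<eta>0 by (simp flip: ennreal_plus)
  have "W (J, l) (t n) = W (t n) (J, l)" by (rule W_sym)
  also have "\<dots> \<le> N (mcost d (t n) (J, l) ?m)" by (rule W_le[OF m])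
  also have "\<dots> \<le> N (\<lambda>u. p u + ((low (ennreal \<delta>) (t n) u + low (ennreal \<delta>) (t n) u) + (q u + q u)))"
  proof (rule N_mono)
    fix u
    show "mcost d (t n) (J, l) ?m u \<le> p u + ((low (ennreal \<delta>) (t n) u + low (ennreal \<delta>) (t n) u) + (q u + q u))"
    proof (cases u)
      case (Inl i)
      show ?thesis
      proof (cases "i \<in> fst (t n)")
        case False
        then show ?thesis using Inl by (simp add: mcost_simps)
      next
        case i: True
        show ?thesis
        proof (cases "e n i \<in> H k")
          case True
          have "mcost d (t n) (J, l) ?m u \<le> ennreal \<eta> + ennreal \<eta>"
          proof (cases "i \<in> K")
            case True
            then show ?thesis using Kd[OF True] i Inl by (simp add: mcost_simps add_increasing2)
          next
            case False
            then have "dA (snd (t n) i) < ennreal \<eta>" using vanish[of "e n i" i] i True unfolding K_def by auto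
            then have "dA (snd (t n) i) + dA (snd (t n) i) \<le> ennreal \<eta> + ennreal \<eta>"
              by (intro add_mono) auto
            then show ?thesis using z(2)[of i] i False Inl by (auto simp: mcost_simps intro: order_trans)
          qed
          then show ?thesis using Inl i True by (simp add: p_def \<eta>\<eta> add_increasing2)
        next
          case False
          then have "dA (snd (t n) i) < ennreal (inverse (real (Suc k)))" using outside_H i by blast
          also have "\<dots> \<le> ennreal \<delta>" using k by (rule ennreal_leI)
          finally have "low (ennreal \<delta>) (t n) u = dA (snd (t n) i)" using i Inl by (simp add: low_simps)
          moreover have "i \<notin> K" using False unfolding K_def by simp
          ultimately show ?thesis using z(2)[of i] i Inl
            by (simp add: mcost_simps add_increasing add_increasing2)
        qed
      qed
    next
      case (Inr j)
      show ?thesis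
      proof (cases "j \<in> J \<and> j \<notin> H k")
        case True
        then show ?thesis using w(2)[of j] Inr by (auto simp: mcost_simps q_def d_sym[of "w j"] add_increasing)
      next
        case False
        then show ?thesis using hit[of j] Inr by (auto simp: mcost_simps)
      qed
    qed
  qed
  also have "\<dots> \<le> N p + N (\<lambda>u. (low (ennreal \<delta>) (t n) u + low (ennreal \<delta>) (t n) u) + (q u + q u))" by (rule N_add)
  also have "N (\<lambda>u. (low (ennreal \<delta>) (t n) u + low (ennreal \<delta>) (t n) u) + (q u + q u))
      \<le> N (\<lambda>u. low (ennreal \<delta>) (t n) u + low (ennreal \<delta>) (t n) u) + N (\<lambda>u. q u + q u)" by (rule N_add)
  also have "N (\<lambda>u. low (ennreal \<delta>) (t n) u + low (ennreal \<delta>) (t n) u) \<le> N (low (ennreal \<delta>) (t n)) + N (low (ennreal \<delta>) (t n))"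
    by (rule N_add)
  also have "\<dots> \<le> ennreal \<epsilon> + ennreal \<epsilon>" using low by (intro add_mono)
  also have "N (\<lambda>u. q u + q u) \<le> N q + N q" by (rule N_add)
  also have "N q \<le> ennreal \<epsilon>"
  proof -
    have "N q \<le> N (tail k)"
    proof (rule N_inj[where \<sigma> = "case_sum Inr Inl"])
      show "inj_on (case_sum Inr Inl) {u. q u \<noteq> 0}" by (rule inj_onI) (auto split: sum.splits)
      fix u show "q u \<le> tail k (case_sum Inr Inl u)" by (cases u) (auto simp: q_def tail_def)
    qed
    then show ?thesis using tail by (rule order_trans)
  qed
  also have "N p \<le> ennreal (2 * \<epsilon>)"
  proof -
    \<comment> \<open>Passing from points to names bounds the support by \<open>H k\<close>, whose
      size does not depend on \<open>n\<close>; \<eta> was fixed through that size.\<close>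
    define p' where "p' = case_sum (\<lambda>j. if j \<in> H k then ennreal (2 * \<eta>) else 0) (\<lambda>_::nat. 0)"
    have "N p \<le> N p'"
    proof (rule N_inj[where \<sigma> = "map_sum (e n) id"])
      show "inj_on (map_sum (e n) id) {u. p u \<noteq> 0}"
      proof (rule inj_onI; clarify)
        fix u v assume u: "p u \<noteq> 0" and v: "p v \<noteq> 0" and eq: "map_sum (e n) id u = map_sum (e n) id v"
        obtain i i' where "u = Inl i" "v = Inl i'" "i \<in> fst (t n)" "i' \<in> fst (t n)"
          using u v by (cases u; cases v) (auto simp: p_def split: if_splits)
        then show "u = v" using eq inj[of n] by (simp add: inj_on_def)
      qed
      fix u show "p u \<le> p' (map_sum (e n) id u)" by (cases u) (auto simp: p_def p'_def)
    qed
    also have "\<dots> \<le> ennreal (2 * \<epsilon>)"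
      using H[of k] by (intro N_finite_le[where F = "Inl ` H k"])
        (use \<epsilon> in \<open>auto simp: p'_def \<eta> card_image split: sum.splits\<close>)
    finally show ?thesis .
  qed
  finally have "W (J, l) (t n) \<le> ennreal (2 * \<epsilon>) + ((ennreal \<epsilon> + ennreal \<epsilon>) + (ennreal \<epsilon> + ennreal \<epsilon>))"
    by (simp add: add_mono add_left_mono add_right_mono)
  also have "\<dots> = ennreal (6 * \<epsilon>)" using \<epsilon> by (simp flip: ennreal_plus)
  finally show ?thesis .
qed

lemma limit_tendsto: "(\<lambda>n. W (J, l) (t n)) \<longlonglongrightarrow> 0"
proof (rule ennreal_tendsto_0I)
  fix r :: real assume r: "0 < r"
  \<comment> \<open>Any divisor above 6 makes the final inequality strict.\<close>
  define \<epsilon> where "\<epsilon> = r / 7"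
  have \<epsilon>: "0 < \<epsilon>" unfolding \<epsilon>_def using r by simp
  obtain \<delta> :: real and k where "0 < \<delta>" and k: "inverse (real (Suc k)) \<le> \<delta>"
    and low: "\<And>n. N (low (ennreal \<delta>) (t n)) \<le> ennreal \<epsilon>" and tail: "N (tail k) \<le> ennreal \<epsilon>"
    by (rule small_tail[OF \<epsilon>]) (rule that)
  define \<eta> where "\<eta> = \<epsilon> / (real (card (H k)) + 1)"
  have "0 < \<eta>" unfolding \<eta>_def using \<epsilon> by (intro divide_pos_pos) auto
  then have \<eta>: "0 < ennreal \<eta>" by (simp add: ennreal_less_zero_iff)
  have 1: "\<forall>\<^sub>F n in sequentially. \<forall>j\<in>H k \<inter> J. \<exists>i\<in>fst (t n). e n i = j \<and> d (l j) (snd (t n) i) < ennreal \<eta>"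
    using H \<eta> by (intro eventually_ball_finite ballI conv) auto
  have 2: "\<forall>\<^sub>F n in sequentially. \<forall>j\<in>H k - J. \<forall>i\<in>fst (t n). e n i = j \<longrightarrow> dA (snd (t n) i) < ennreal \<eta>"
    using H \<eta> by (intro eventually_ball_finite ballI van) auto
  from 1 2 show "\<forall>\<^sub>F n in sequentially. W (J, l) (t n) < ennreal r"
  proof eventually_elim
    case (elim n)
    have "W (J, l) (t n) \<le> ennreal (6 * \<epsilon>)"
      by (rule limit_matching[OF k low tail \<epsilon> \<eta>_def]) (use elim in auto)
    also have "\<dots> < ennreal r" using r by (simp add: \<epsilon>_def ennreal_less_iff)
    finally show ?case .
  qed
qed

end

section \<open>Common names, the diagonal subsequence and sufficiency\<close>

lemma uniform_enumeration:
  assumes S: "S \<subseteq> DN" and ufin: "unif_upper_finite d A S"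
  shows "\<exists>(H :: nat \<Rightarrow> nat set) (e :: 'a dgm \<Rightarrow> nat \<Rightarrow> nat). (\<forall>k. finite (H k)) \<and>
    (\<forall>\<alpha>\<in>S. inj_on (e \<alpha>) (fst \<alpha>) \<and>
      (\<forall>i\<in>fst \<alpha>. \<forall>k. ennreal (inverse (real (Suc k))) \<le> dA (snd \<alpha> i) \<longrightarrow> e \<alpha> i \<in> H k))"
proof -
  let ?u = "\<lambda>k. ennreal (inverse (real (Suc k)))"
  let ?U = "\<lambda>k \<alpha>. fst (upper d A (?u k) \<alpha>)"
  have "\<forall>k. \<exists>M. \<forall>\<alpha>\<in>S. finite (?U k \<alpha>) \<and> card (?U k \<alpha>) \<le> M"
    using ufin unfolding unif_upper_finite_def by simp
  then obtain M where M: "\<And>k \<alpha>. \<alpha> \<in> S \<Longrightarrow> finite (?U k \<alpha>) \<and> card (?U k \<alpha>) \<le> M k"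
    unfolding choice_iff by blast
  have "\<forall>\<alpha> k. \<exists>b. \<alpha> \<in> S \<longrightarrow> b ` ?U k \<alpha> \<subseteq> {..<M k} \<and> inj_on b (?U k \<alpha>)"
  proof (intro allI)
    fix \<alpha> k
    show "\<exists>b. \<alpha> \<in> S \<longrightarrow> b ` ?U k \<alpha> \<subseteq> {..<M k} \<and> inj_on b (?U k \<alpha>)"
      using card_le_inj[of "?U k \<alpha>" "{..<M k}"] M[of \<alpha> k] by auto
  qed
  then obtain b where b: "\<And>\<alpha> k. \<alpha> \<in> S \<Longrightarrow> b \<alpha> k ` ?U k \<alpha> \<subseteq> {..<M k}"
    "\<And>\<alpha> k. \<alpha> \<in> S \<Longrightarrow> inj_on (b \<alpha> k) (?U k \<alpha>)"
    unfolding choice_iff by blast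
  \<comment> \<open>A name is the pair of the shell of a point and its number among the points at
    least that far from \<open>A\<close>. Numbers in shell k stay below \<open>M k\<close> for every
    diagram, so only finitely many names have shell at most k.\<close>
  define sh where "sh \<alpha> i = (LEAST k. ?u k \<le> dA (snd \<alpha> i))" for \<alpha> :: "'a dgm" and i
  define e where "e \<alpha> i = prod_encode (sh \<alpha> i, b \<alpha> (sh \<alpha> i) i)" for \<alpha> i
  define H where "H k = prod_encode ` (SIGMA k':{..k}. {..<M k'})" for k
  have shell: "i \<in> ?U (sh \<alpha> i) \<alpha>" if "\<alpha> \<in> S" "i \<in> fst \<alpha>" for \<alpha> i
  proof -
    have "snd \<alpha> i \<notin> A" using S that unfolding DN_def Dbar_def by auto
    then have "0 < dA (snd \<alpha> i)" by (rule dA_pos)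
    then obtain r :: real where r: "0 < r" "ennreal r \<le> dA (snd \<alpha> i)" by (rule ennreal_pos_real_below)
    then obtain k where "inverse (real (Suc k)) < r" using reals_Archimedean by blast
    then have "?u k \<le> ennreal r" by (intro ennreal_leI) simp
    then have "?u k \<le> dA (snd \<alpha> i)" using r(2) by (rule order_trans)
    then have "?u (sh \<alpha> i) \<le> dA (snd \<alpha> i)" unfolding sh_def by (rule LeastI)
    then show ?thesis using that by (simp add: mem_upper_iff)
  qed
  show ?thesis
  proof (intro exI[of _ H] exI[of _ e] conjI allI ballI impI)
    show "finite (H k)" for k unfolding H_def by simp
    show "inj_on (e \<alpha>) (fst \<alpha>)" if "\<alpha> \<in> S" for \<alpha>
    proof (rule inj_onI)
      fix i i' assume i: "i \<in> fst \<alpha>" "i' \<in> fst \<alpha>" "e \<alpha> i = e \<alpha> i'"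
      then have "sh \<alpha> i = sh \<alpha> i'" "b \<alpha> (sh \<alpha> i) i = b \<alpha> (sh \<alpha> i) i'" unfolding e_def by auto
      then show "i = i'" using b(2)[OF that, of "sh \<alpha> i"] shell[OF that i(1)] shell[OF that i(2)]
        by (simp add: inj_on_def)
    qed
    show "e \<alpha> i \<in> H k" if "\<alpha> \<in> S" "i \<in> fst \<alpha>" "?u k \<le> dA (snd \<alpha> i)" for \<alpha> i k
    proof -
      have "sh \<alpha> i \<le> k" unfolding sh_def using that(3) by (rule Least_le)
      moreover have "b \<alpha> (sh \<alpha> i) i < M (sh \<alpha> i)" using b(1)[OF that(1)] shell[OF that(1,2)] by blast
      ultimately show ?thesis unfolding e_def H_def by auto
    qed
  qed
qed

lemma imp_rel_compact:
  assumes S: "S \<subseteq> DN" and ufin: "unif_upper_finite d A S" and urc: "upper_rel_compact d A S"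
    and van: "N_vanishing S"
  shows "rel_compact_in (ball_topology DN W) S"
proof (rule ext_pmetric_on.seq_imp_rel_compact[OF W_ext_pmetric_on S])
  fix s assume s: "\<And>n::nat. s n \<in> S"
  obtain H :: "nat \<Rightarrow> nat set" and e :: "'a dgm \<Rightarrow> nat \<Rightarrow> nat" where He: "(\<forall>k. finite (H k)) \<and> (\<forall>\<alpha>\<in>S. inj_on (e \<alpha>) (fst \<alpha>) \<and>
      (\<forall>i\<in>fst \<alpha>. \<forall>k. ennreal (inverse (real (Suc k))) \<le> dA (snd \<alpha> i) \<longrightarrow> e \<alpha> i \<in> H k))"
    using uniform_enumeration[OF S ufin] by blast
  have H: "\<And>k. finite (H k)" and e: "\<And>\<alpha>. \<alpha> \<in> S \<Longrightarrow> inj_on (e \<alpha>) (fst \<alpha>)"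
    and eH: "\<And>\<alpha> k i. \<alpha> \<in> S \<Longrightarrow> i \<in> fst \<alpha> \<Longrightarrow> ennreal (inverse (real (Suc k))) \<le> dA (snd \<alpha> i) \<Longrightarrow> e \<alpha> i \<in> H k"
    using He by auto
  \<comment> \<open>\<open>conv\<close> requires the name \<open>j\<close> to occur eventually and
    its limit to lie off \<open>A\<close>, as a point of a diagram must; \<open>vanish\<close> also
    holds if the name ceases to occur.\<close>
  define conv where "conv j r x \<longleftrightarrow> x \<notin> A \<and> (\<forall>c>0. \<forall>\<^sub>F n in sequentially.
      \<exists>i\<in>fst (s (r n)). e (s (r n)) i = j \<and> d x (snd (s (r n)) i) < c)" for j x and r :: "nat \<Rightarrow> nat"
  define vanish where "vanish j r \<longleftrightarrow> (\<forall>c>0. \<forall>\<^sub>F n in sequentially.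
      \<forall>i\<in>fst (s (r n)). e (s (r n)) i = j \<longrightarrow> dA (snd (s (r n)) i) < c)" for j and r :: "nat \<Rightarrow> nat"
  interpret subseqs "\<lambda>j r. (\<exists>x. conv j r x) \<or> vanish j r"
  proof
    fix j and r :: "nat \<Rightarrow> nat" assume r: "strict_mono r"
    show "\<exists>r'. strict_mono r' \<and> ((\<exists>x. conv j (r \<circ> r') x) \<or> vanish j (r \<circ> r'))"
    proof (cases "vanish j r")
      case True
      then show ?thesis by (intro exI[of _ id]) (simp add: strict_mono_id)
    next
      case False
      \<comment> \<open>Infinitely many diagrams then carry a point named \<open>j\<close> at
        distance at least \<open>c\<close> from \<open>A\<close>. Upper relative compactness makes
        these points converge along a subsequence, and the bound \<open>c\<close> keeps the limit
        off \<open>A\<close>.\<close>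
      then obtain c where c: "0 < c" and "\<not> (\<forall>\<^sub>F n in sequentially. \<forall>i\<in>fst (s (r n)). e (s (r n)) i = j \<longrightarrow> dA (snd (s (r n)) i) < c)"
        unfolding vanish_def by blast
      then have "\<exists>\<^sub>F n in sequentially. \<exists>i\<in>fst (s (r n)). e (s (r n)) i = j \<and> c \<le> dA (snd (s (r n)) i)"
        unfolding frequently_def by (simp add: not_le)
      then have "infinite {n. \<exists>i\<in>fst (s (r n)). e (s (r n)) i = j \<and> c \<le> dA (snd (s (r n)) i)}"
        by (simp add: frequently_cofinite cofinite_eq_sequentially[symmetric])
      then obtain r1 :: "nat \<Rightarrow> nat" where r1: "strict_mono r1"
        "\<forall>n. r1 n \<in> {n. \<exists>i\<in>fst (s (r n)). e (s (r n)) i = j \<and> c \<le> dA (snd (s (r n)) i)}"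
        using infinite_enumerate by blast
      then have "\<forall>n. \<exists>i. i \<in> fst (s (r (r1 n))) \<and> e (s (r (r1 n))) i = j \<and> c \<le> dA (snd (s (r (r1 n))) i)"
        by (simp add: Bex_def)
      then obtain \<iota> where \<iota>: "\<And>n. \<iota> n \<in> fst (s (r (r1 n)))" "\<And>n. e (s (r (r1 n))) (\<iota> n) = j"
        "\<And>n. c \<le> dA (snd (s (r (r1 n))) (\<iota> n))" unfolding choice_iff by blast
      obtain \<epsilon> :: real where \<epsilon>: "0 < \<epsilon>" "ennreal \<epsilon> \<le> c" using c by (rule ennreal_pos_real_below)
      have U: "snd (s (r (r1 n))) (\<iota> n) \<in> (\<Union>\<alpha>\<in>S. supp (upper d A (ennreal \<epsilon>) \<alpha>))" for n
      proof
        show "s (r (r1 n)) \<in> S" by (rule s)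
        have "ennreal \<epsilon> \<le> dA (snd (s (r (r1 n))) (\<iota> n))" using \<epsilon>(2) \<iota>(3) by (rule order_trans)
        then show "snd (s (r (r1 n))) (\<iota> n) \<in> supp (upper d A (ennreal \<epsilon>) (s (r (r1 n))))"
          using \<iota>(1)[of n] unfolding supp_def snd_upper by (intro imageI) (simp add: mem_upper_iff)
      qed
      have rc: "rel_compact_in (ball_topology UNIV d) (\<Union>\<alpha>\<in>S. supp (upper d A (ennreal \<epsilon>) \<alpha>))"
        using urc \<epsilon>(1) unfolding upper_rel_compact_def by blast
      obtain x and r2 :: "nat \<Rightarrow> nat" where "x \<in> UNIV" and r2: "strict_mono r2"
        and x: "(\<lambda>n. d x (snd (s (r (r1 (r2 n)))) (\<iota> (r2 n)))) \<longlonglongrightarrow> 0"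
        by (rule ext_pmetric_on.rel_compact_imp_seq[where s = "\<lambda>n. snd (s (r (r1 n))) (\<iota> n)", OF d_ext_pmetric_on subset_UNIV rc])
          (rule U, rule that)
      have "x \<notin> A"
      proof
        assume "x \<in> A"
        obtain n where "d x (snd (s (r (r1 (r2 n)))) (\<iota> (r2 n))) < c"
          using x c by (rule tendsto_0_ex_less)
        moreover have "c \<le> d x (snd (s (r (r1 (r2 n)))) (\<iota> (r2 n)))"
          using \<iota>(3)[of "r2 n"] dA_le[OF \<open>x \<in> A\<close>] d_sym by (metis order_trans)
        ultimately show False by simp
      qed
      moreover have "\<forall>\<^sub>F n in sequentially. \<exists>i\<in>fst (s (r (r1 (r2 n)))). e (s (r (r1 (r2 n)))) i = j \<and> d x (snd (s (r (r1 (r2 n)))) i) < c'"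
        if "0 < c'" for c'
        using order_tendstoD(2)[OF x that] by eventually_elim (use \<iota>(1,2) in blast)
      ultimately have "conv j (r \<circ> (r1 \<circ> r2)) x" unfolding conv_def by simp
      moreover have "strict_mono (r1 \<circ> r2)" using r1(1) r2 by (rule strict_mono_o)
      ultimately show ?thesis by blast
    qed
  qed
  have stable: "(\<exists>x. conv j (q \<circ> r) x) \<or> vanish j (q \<circ> r)"
    if r: "strict_mono r" and P: "(\<exists>x. conv j q x) \<or> vanish j q" for r q :: "nat \<Rightarrow> nat" and j
  proof -
    have sub: "\<forall>\<^sub>F n in sequentially. Q (q (r n))" if "\<forall>\<^sub>F n in sequentially. Q (q n)" for Q
      using eventually_subseq[OF r that] .
    show ?thesis using P
    proof
      assume "\<exists>x. conv j q x"
      then obtain x where "conv j q x" by blast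
      then have "conv j (q \<circ> r) x" unfolding conv_def o_def by (auto intro!: sub)
      then show ?thesis by blast
    next
      assume "vanish j q"
      then have "vanish j (q \<circ> r)" unfolding vanish_def o_def by (auto intro!: sub)
      then show ?thesis by blast
    qed
  qed
  \<comment> \<open>The diagonal sequence refines the j-th subsequence only after finitely many
    terms; both alternatives ignore initial segments.\<close>
  have shift: "(\<forall>\<^sub>F n in sequentially. Q (m + n)) \<longleftrightarrow> (\<forall>\<^sub>F n in sequentially. Q n)" for Q and m :: nat
    using eventually_sequentially_seg[of Q m] by (simp add: add.commute)
  have "conv j (q \<circ> (+) m) x \<longleftrightarrow> conv j q x" for j q m x
    unfolding conv_def using shift[of "\<lambda>n. \<exists>i\<in>fst (s (q n)). e (s (q n)) i = j \<and> d x (snd (s (q n)) i) < _" m]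
    by simp
  moreover have "vanish j (q \<circ> (+) m) \<longleftrightarrow> vanish j q" for j q m
    unfolding vanish_def using shift[of "\<lambda>n. \<forall>i\<in>fst (s (q n)). e (s (q n)) i = j \<longrightarrow> dA (snd (s (q n)) i) < _" m]
    by simp
  moreover have "(\<exists>x. conv j (diagseq \<circ> (+) (Suc j)) x) \<or> vanish j (diagseq \<circ> (+) (Suc j))" for j
    by (rule diagseq_holds) (rule stable)
  ultimately have diag: "(\<exists>x. conv j diagseq x) \<or> vanish j diagseq" for j by simp
  define J where "J = {j. \<exists>x. conv j diagseq x}"
  define l where "l j = (SOME x. conv j diagseq x)" for j
  have l: "conv j diagseq (l j)" if "j \<in> J" for j
    using that unfolding J_def l_def by (auto intro: someI)
  have nl: "vanish j diagseq" if "j \<notin> J" for j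
    using that diag[of j] unfolding J_def by blast
  let ?t = "\<lambda>n. s (diagseq n)"
  have t: "?t n \<in> Dbar A" for n using s[of "diagseq n"] S unfolding DN_def by auto
  have V: "\<exists>\<delta>::real. 0 < \<delta> \<and> (\<forall>n. N (low (ennreal \<delta>) (?t n)) < ennreal \<epsilon>)" if "0 < \<epsilon>" for \<epsilon> :: real
    using van that s unfolding N_vanishing_def by meson
  have lA: "l j \<notin> A" if "j \<in> J" for j using l[OF that] unfolding conv_def by blast
  have cv: "\<forall>\<^sub>F n in sequentially. \<exists>i\<in>fst (?t n). e (?t n) i = j \<and> d (l j) (snd (?t n) i) < c"
    if "j \<in> J" "0 < c" for j c using l[OF that(1)] that(2) unfolding conv_def by blast
  have vn: "\<forall>\<^sub>F n in sequentially. \<forall>i\<in>fst (?t n). e (?t n) i = j \<longrightarrow> dA (snd (?t n) i) < c"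
    if "j \<notin> J" "0 < c" for j c using nl[OF that(1)] that(2) unfolding vanish_def by blast
  have "(J, l) \<in> DN"
    by (rule limit_in_DN[where t = ?t and e = "\<lambda>n. e (?t n)" and H = H])
      (rule t e[OF s] H eH[OF s] lA cv vn V; assumption)+
  moreover have "(\<lambda>n. W (J, l) (?t n)) \<longlonglongrightarrow> 0"
    by (rule limit_tendsto[where t = ?t and e = "\<lambda>n. e (?t n)" and H = H])
      (rule t e[OF s] H eH[OF s] lA cv vn V; assumption)+
  ultimately show "\<exists>l\<in>DN. \<exists>r::nat\<Rightarrow>nat. strict_mono r \<and> (\<lambda>n. W l (s (r n))) \<longlonglongrightarrow> 0"
    using subseq_diagseq by blast
qed

lemma rel_compact_iff:
  assumes "S \<subseteq> DN"
  shows "rel_compact_in (ball_topology DN W) S \<longleftrightarrow>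
    unif_upper_finite d A S \<and> upper_rel_compact d A S \<and> N_vanishing S"
  using imp_rel_compact rel_compact_imp_upper_finite rel_compact_imp_upper_rel_compact
    rel_compact_imp_vanishing assms by blast

end

section \<open>The \<open>\<ell>\<^sup>p\<close> and sup norms\<close>

text \<open>Jensen for \<open>x powr p\<close> with weights \<open>s/(s+t)\<close>, \<open>t/(s+t)\<close>; summed over the index set with \<open>s\<close>, \<open>t\<close>
  slightly above the two norms it gives Minkowski's inequality.\<close>

lemma powr_add_le_weighted:
  fixes s t u v p :: real
  assumes p: "1 \<le> p" and st: "0 < s" "0 < t" and uv: "0 \<le> u" "0 \<le> v"
  shows "((u + v) / (s + t)) powr p \<le> s / (s + t) * (u / s) powr p + t / (s + t) * (v / t) powr p"
proof -
  \<comment> \<open>Serves the case of a zero value, since convexity is applied below only at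
    positive points; it rests on r powr p \<le> r for 0 \<le> r \<le> 1.\<close>
  have shrink: "(x / (a + b)) powr p \<le> a / (a + b) * (x / a) powr p"
    if "0 \<le> x" "0 < a" "0 < b" for x a b :: real
  proof -
    have "x / (a + b) = a / (a + b) * (x / a)" using that by simp
    then have "(x / (a + b)) powr p = (a / (a + b)) powr p * (x / a) powr p"
      using that by (simp only:) (rule powr_mult; simp)
    also have "(a / (a + b)) powr p \<le> (a / (a + b)) powr 1"
      using that p by (intro powr_mono') auto
    finally show ?thesis using that by (simp add: mult_right_mono)
  qed
  show ?thesis
  proof (cases "u = 0 \<or> v = 0")
    case True
    then show ?thesis using shrink[of v t s] shrink[of u s t] st uv by (auto simp: add.commute)
  next
    case False
    then have pos: "0 < u / s" "0 < v / t" using uv st by auto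
    have ab: "1 - t / (s + t) = s / (s + t)" using st by (simp add: field_simps)
    have "((1 - t / (s + t)) *\<^sub>R (u / s) + (t / (s + t)) *\<^sub>R (v / t)) powr p
        \<le> (1 - t / (s + t)) * (u / s) powr p + t / (s + t) * (v / t) powr p"
      using pos st by (intro convex_onD[OF powr_convex[OF p]]) auto
    then show ?thesis using st unfolding ab by (simp add: add_divide_distrib)
  qed
qed

lemma epowr_ennreal: "0 \<le> x \<Longrightarrow> epowr (ennreal x) q = ennreal (x powr q)"
  by (simp add: epowr_def)

lemma epowr_top: "epowr top q = top"
  by (simp add: epowr_def)

lemma epowr_0: "epowr 0 q = 0"
  by (simp add: epowr_def)

lemma epowr_epowr:
  assumes "0 < q" "0 < r" "q * r = 1"
  shows "epowr (epowr c q) r = c"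
  by (cases c) (simp_all add: epowr_ennreal epowr_top powr_powr assms)

lemma epowr_mono: "0 < q \<Longrightarrow> c \<le> c' \<Longrightarrow> epowr c q \<le> epowr c' q"
  by (cases c; cases c') (auto simp: epowr_ennreal epowr_top top_unique intro!: ennreal_leI powr_mono2)

lemma epowr_le_iff:
  assumes "0 < q" shows "epowr c (1 / q) \<le> c' \<longleftrightarrow> c \<le> epowr c' q"
proof
  assume "epowr c (1 / q) \<le> c'"
  then have "epowr (epowr c (1 / q)) q \<le> epowr c' q" by (rule epowr_mono[OF assms])
  then show "c \<le> epowr c' q" using assms by (simp add: epowr_epowr)
next
  assume "c \<le> epowr c' q"
  then have "epowr c (1 / q) \<le> epowr (epowr c' q) (1 / q)" using assms by (intro epowr_mono) auto
  then show "epowr c (1 / q) \<le> c'" using assms by (simp add: epowr_epowr)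
qed

text \<open>The weighted inequality multiplied by the p-th power of s + t. Its right side is linear
  in the p-th powers with constant coefficients, so it can be summed over indices.\<close>

lemma epowr_add_le:
  fixes s t p :: real
  assumes p: "1 \<le> p" and st: "0 < s" "0 < t"
  defines "C \<equiv> \<lambda>r. (s + t) powr p * (r / (s + t) / r powr p)"
  shows "epowr (x + y) p \<le> ennreal (C s) * epowr x p + ennreal (C t) * epowr y p"
proof (cases "x = top \<or> y = top")
  case True
  have "0 < C s" "0 < C t" using st unfolding C_def by auto
  then have "ennreal (C s) * epowr x p + ennreal (C t) * epowr y p = top"
    using True by (auto simp: epowr_top ennreal_mult_top)
  then show ?thesis by (simp only: top_greatest)
next
  case False
  then obtain u v where uv: "0 \<le> u" "x = ennreal u" "0 \<le> v" "y = ennreal v"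
    by (cases x; cases y) auto
  have C0: "0 \<le> C s" "0 \<le> C t" using st unfolding C_def by auto
  have "(u + v) powr p = (s + t) powr p * ((u + v) / (s + t)) powr p"
    using uv st by (simp add: powr_divide)
  also have "\<dots> \<le> (s + t) powr p * (s / (s + t) * (u / s) powr p + t / (s + t) * (v / t) powr p)"
    using powr_add_le_weighted[OF p st uv(1,3)] by (rule mult_left_mono) simp
  also have "\<dots> = C s * u powr p + C t * v powr p"
    using uv st unfolding C_def by (simp add: powr_divide algebra_simps)
  finally have "ennreal ((u + v) powr p) \<le> ennreal (C s * u powr p + C t * v powr p)" by (rule ennreal_leI)
  moreover have "epowr (x + y) p = ennreal ((u + v) powr p)"
    using epowr_ennreal[of "u + v" p] uv by simp
  moreover have "ennreal (C s) * epowr x p + ennreal (C t) * epowr y p = ennreal (C s * u powr p + C t * v powr p)"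
    using uv C0 by (simp add: epowr_ennreal ennreal_mult)
  ultimately show ?thesis by simp
qed

text \<open>The identity that closes Minkowski's inequality: with the p-th power sums bounded by
  those of s and t, the coefficients of \<open>epowr_add_le\<close> recombine exactly.\<close>

lemma epowr_add_le_const:
  fixes s t p :: real
  assumes "0 < s" "0 < t"
  shows "(s + t) powr p * (s / (s + t) / s powr p) * s powr p
    + (s + t) powr p * (t / (s + t) / t powr p) * t powr p = (s + t) powr p"
proof -
  have "(s + t) powr p * (s / (s + t) / s powr p) * s powr p
    + (s + t) powr p * (t / (s + t) / t powr p) * t powr p = (s + t) powr p * (s / (s + t) + t / (s + t))"
    using assms by (simp add: distrib_left)
  also have "s / (s + t) + t / (s + t) = 1" using assms by (simp add: add_divide_distrib[symmetric])
  finally show ?thesis by simp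
qed

definition lp_norm :: "real \<Rightarrow> ('i \<Rightarrow> ennreal) \<Rightarrow> ennreal" where
  "lp_norm p g = epowr (\<Sum>\<^sub>\<infinity>i. epowr (g i) p) (1 / p)"

lemma lp_norm_le_iff:
  "0 < p \<Longrightarrow> lp_norm p g \<le> c \<longleftrightarrow> (\<Sum>\<^sub>\<infinity>i. epowr (g i) p) \<le> epowr c p"
  unfolding lp_norm_def by (rule epowr_le_iff)

lemma summable_on_ennreal_valued: "(f :: 'i \<Rightarrow> ennreal) summable_on A"
  by (rule nonneg_summable_on_complete) simp

lemma infsum_ennreal_mono_set:
  fixes f :: "'i \<Rightarrow> ennreal"
  assumes "A \<subseteq> B" shows "infsum f A \<le> infsum f B"
  using assms by (intro infsum_mono_neutral summable_on_ennreal_valued) auto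

lemma lp_norm_add:
  assumes p: "1 \<le> p"
  shows "lp_norm p (\<lambda>i. g i + h i) \<le> lp_norm p g + lp_norm p h"
proof (rule ennreal_le_epsilon)
  fix e :: real assume fin: "lp_norm p g + lp_norm p h < top" and e: "0 < e"
  obtain a where a: "0 \<le> a" "lp_norm p g = ennreal a" using fin by (cases "lp_norm p g") auto
  obtain b where b: "0 \<le> b" "lp_norm p h = ennreal b" using fin by (cases "lp_norm p h") auto
  \<comment> \<open>The slack keeps both weights positive even if a norm is 0.\<close>
  define s t where "s = a + e/2" and "t = b + e/2"
  have st: "0 < s" "0 < t" using a b e unfolding s_def t_def by auto
  have p0: "0 < p" using p by simp
  have S: "(\<Sum>\<^sub>\<infinity>i. epowr (g i) p) \<le> ennreal (s powr p)"
    using lp_norm_le_iff[OF p0, of g "ennreal s"] a st e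
    by (simp add: epowr_ennreal) (simp add: s_def ennreal_leI)
  have T: "(\<Sum>\<^sub>\<infinity>i. epowr (h i) p) \<le> ennreal (t powr p)"
    using lp_norm_le_iff[OF p0, of h "ennreal t"] b st e
    by (simp add: epowr_ennreal) (simp add: t_def ennreal_leI)
  define C where "C = (\<lambda>r. (s + t) powr p * (r / (s + t) / r powr p))"
  have C0: "0 \<le> C s" "0 \<le> C t" using st unfolding C_def by auto
  have "(\<Sum>\<^sub>\<infinity>i. epowr (g i + h i) p) \<le> ennreal ((s + t) powr p)"
  proof (rule infsum_le_finite_sums)
    fix F :: "'a set" assume F: "finite F"
    have fin: "sum f F \<le> infsum f UNIV" for f :: "'a \<Rightarrow> ennreal"
      using infsum_ennreal_mono_set[of F UNIV f] F by simp
    have "(\<Sum>i\<in>F. epowr (g i + h i) p) \<le> (\<Sum>i\<in>F. ennreal (C s) * epowr (g i) p + ennreal (C t) * epowr (h i) p)"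
      unfolding C_def by (intro sum_mono epowr_add_le p st)
    also have "\<dots> = ennreal (C s) * (\<Sum>i\<in>F. epowr (g i) p) + ennreal (C t) * (\<Sum>i\<in>F. epowr (h i) p)"
      by (simp add: sum.distrib sum_distrib_left)
    also have "\<dots> \<le> ennreal (C s) * ennreal (s powr p) + ennreal (C t) * ennreal (t powr p)"
      using order_trans[OF fin S] order_trans[OF fin T] by (intro add_mono mult_left_mono) auto
    also have "\<dots> = ennreal (C s * s powr p + C t * t powr p)"
      using C0 by (simp add: ennreal_mult)
    also have "\<dots> = ennreal ((s + t) powr p)"
      using epowr_add_le_const[OF st, of p] unfolding C_def by simp
    finally show "(\<Sum>i\<in>F. epowr (g i + h i) p) \<le> ennreal ((s + t) powr p)" .
  qed (rule summable_on_ennreal_valued)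
  then have "lp_norm p (\<lambda>i. g i + h i) \<le> ennreal (s + t)"
    using st unfolding lp_norm_le_iff[OF p0] by (subst epowr_ennreal) auto
  also have "\<dots> = lp_norm p g + lp_norm p h + ennreal e"
    using a b e by (simp add: s_def t_def flip: ennreal_plus)
  finally show "lp_norm p (\<lambda>i. g i + h i) \<le> lp_norm p g + lp_norm p h + ennreal e" .
qed

lemma lp_norm_cost_norm:
  assumes p: "1 \<le> p" shows "cost_norm (lp_norm p)"
proof
  have p0: "0 < p" using p by simp
  fix g h :: "nat + nat \<Rightarrow> ennreal" and \<sigma> c i
  show "lp_norm p (\<lambda>i. g i + h i) \<le> lp_norm p g + lp_norm p h" using p by (rule lp_norm_add)
  show "lp_norm p g \<le> lp_norm p h" if inj: "inj_on \<sigma> {i. g i \<noteq> 0}" and le: "\<And>i. g i \<noteq> 0 \<Longrightarrow> g i \<le> h (\<sigma> i)"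
  proof -
    let ?G = "{i. g i \<noteq> 0}"
    have "(\<Sum>\<^sub>\<infinity>i. epowr (g i) p) = (\<Sum>\<^sub>\<infinity>i\<in>?G. epowr (g i) p)"
      by (rule infsum_cong_neutral) (auto simp: epowr_0)
    also have "\<dots> \<le> (\<Sum>\<^sub>\<infinity>i\<in>?G. epowr (h (\<sigma> i)) p)"
      using le p0 by (intro infsum_mono epowr_mono summable_on_ennreal_valued) auto
    also have "\<dots> = (\<Sum>\<^sub>\<infinity>i\<in>\<sigma> ` ?G. epowr (h i) p)"
      using infsum_reindex[OF inj, of "\<lambda>i. epowr (h i) p"] by (simp add: o_def)
    also have "\<dots> \<le> (\<Sum>\<^sub>\<infinity>i. epowr (h i) p)" by (rule infsum_ennreal_mono_set) simp
    finally show ?thesis unfolding lp_norm_def using p0 by (intro epowr_mono) auto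
  qed
  have "epowr (g i) p \<le> (\<Sum>\<^sub>\<infinity>i. epowr (g i) p)"
    using infsum_ennreal_mono_set[of "{i}" UNIV "\<lambda>i. epowr (g i) p"] by simp
  also have "\<dots> \<le> epowr (lp_norm p g) p" using lp_norm_le_iff[OF p0] by blast
  finally have "epowr (epowr (g i) p) (1 / p) \<le> lp_norm p g" using p0 by (simp add: epowr_le_iff)
  then show "g i \<le> lp_norm p g" using p0 by (simp add: epowr_epowr)
  have "(\<Sum>\<^sub>\<infinity>j. epowr (if j = i then c else 0) p) = (\<Sum>\<^sub>\<infinity>j\<in>{i}. epowr c p)"
    by (rule infsum_cong_neutral) (auto simp: epowr_0)
  then show "lp_norm p (\<lambda>j. if j = i then c else 0) \<le> c" by (simp add: lp_norm_le_iff[OF p0])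
  show "lp_norm p g \<le> c" if le: "\<And>F. finite F \<Longrightarrow> lp_norm p (\<lambda>i. if i \<in> F then g i else 0) \<le> c"
    unfolding lp_norm_le_iff[OF p0]
  proof (rule infsum_le_finite_sums)
    fix F :: "(nat + nat) set" assume F: "finite F"
    have "(\<Sum>\<^sub>\<infinity>i. epowr (if i \<in> F then g i else 0) p) = (\<Sum>\<^sub>\<infinity>i\<in>F. epowr (g i) p)"
      by (rule infsum_cong_neutral) (auto simp: epowr_0)
    then show "(\<Sum>i\<in>F. epowr (g i) p) \<le> epowr c p" using le[OF F] F by (simp add: lp_norm_le_iff[OF p0])
  qed (rule summable_on_ennreal_valued)
qed

text \<open>Specific to finite p: constant families on an infinite set refute it for the sup norm.
  Hence it is kept out of \<open>cost_norm\<close> and enters \<open>DN_alt\<close> as a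
  hypothesis.\<close>

lemma lp_norm_tail:
  assumes p: "1 \<le> p" and fin: "lp_norm p g < top" and \<epsilon>: "0 < \<epsilon>"
  obtains F where "finite F" "lp_norm p (\<lambda>i. if i \<in> F then 0 else g i) < ennreal \<epsilon>"
proof -
  have p0: "0 < p" using p by simp
  let ?f = "\<lambda>i. epowr (g i) p"
  define T where "T = (\<Sum>\<^sub>\<infinity>i. ?f i)"
  define \<eta> where "\<eta> = ennreal ((\<epsilon>/2) powr p)"
  have \<eta>: "0 < \<eta>" unfolding \<eta>_def using \<epsilon> by (simp add: ennreal_less_zero_iff)
  have T: "T < top" using fin unfolding lp_norm_def T_def[symmetric]
    by (cases T) (auto simp: epowr_top)
  have "\<exists>F. finite F \<and> T < sum ?f F + \<eta>"
  \<comment> \<open>Subtraction is truncated at 0, so T - \<eta> < T fails for T = 0.\<close>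
  proof (cases "T = 0")
    case True
    then show ?thesis using \<eta> by (intro exI[of _ "{}"]) simp
  next
    case False
    then have "T - \<eta> < T" using T \<eta> by (intro ennreal_between) (auto simp: zero_less_iff_neq_zero)
    also have "T = (SUP F\<in>{F. finite F \<and> F \<subseteq> UNIV}. sum ?f F)"
      unfolding T_def by (rule nonneg_infsum_complete) simp
    finally obtain F where F: "finite F" "T - \<eta> < sum ?f F" unfolding less_SUP_iff by auto
    have "T < sum ?f F + \<eta>"
    proof (rule ccontr)
      assume "\<not> ?thesis"
      then have "sum ?f F + \<eta> - \<eta> \<le> T - \<eta>" by (intro ennreal_minus_mono) auto
      then show False using F(2) by (simp add: \<eta>_def)
    qed
    then show ?thesis using F(1) by blast
  qed
  then obtain F where F: "finite F" "T < sum ?f F + \<eta>" by blast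
  let ?g = "\<lambda>i. if i \<in> F then 0 else g i"
  have "T = infsum ?f (F \<union> - F)" unfolding T_def by simp
  also have "\<dots> = infsum ?f F + infsum ?f (- F)" by (intro infsum_Un_disjoint summable_on_ennreal_valued) auto
  finally have "sum ?f F + infsum ?f (- F) < sum ?f F + \<eta>" using F by simp
  then have "infsum ?f (- F) < \<eta>" by (simp add: ennreal_add_left_cancel_less)
  also have "infsum ?f (- F) = (\<Sum>\<^sub>\<infinity>i. epowr (?g i) p)"
    by (rule infsum_cong_neutral) (auto simp: epowr_0)
  finally have "lp_norm p ?g \<le> ennreal (\<epsilon>/2)"
    using \<epsilon> by (simp add: lp_norm_le_iff[OF p0] epowr_ennreal \<eta>_def)
  also have "\<dots> < ennreal \<epsilon>" using \<epsilon> by (simp add: ennreal_less_iff)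
  finally show ?thesis using that F(1) by blast
qed

lemma sup_norm_cost_norm: "cost_norm (\<lambda>g. SUP i. g i)"
proof
  fix g h :: "nat + nat \<Rightarrow> ennreal" and \<sigma> i and c :: ennreal
  show "(SUP i. g i + h i) \<le> (SUP i. g i) + (SUP i. h i)"
    by (intro SUP_least add_mono SUP_upper) auto
  show "(SUP i. g i) \<le> (SUP i. h i)" if le: "\<And>i. g i \<noteq> 0 \<Longrightarrow> g i \<le> h (\<sigma> i)"
  proof (rule SUP_least)
    fix i show "g i \<le> (SUP i. h i)"
      using le[of i] by (cases "g i = 0") (auto intro: SUP_upper2)
  qed
  show "g i \<le> (SUP i. g i)" by (rule SUP_upper) simp
  show "(SUP j. if j = i then c else 0) \<le> c" by (rule SUP_least) simp
  show "(SUP i. g i) \<le> c" if le: "\<And>F. finite F \<Longrightarrow> (SUP i. if i \<in> F then g i else 0) \<le> c"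
  proof (rule SUP_least)
    fix i
    have "g i \<le> (SUP j. if j \<in> {i} then g j else 0)" by (rule SUP_upper2[of i]) auto
    also have "\<dots> \<le> c" by (rule le) simp
    finally show "g i \<le> c" .
  qed
qed

lemma icost_eq_mcost:
  assumes "is_matching A \<alpha> \<beta> m"
  shows "icost d \<alpha> \<beta> m = (SUP u. mcost d \<alpha> \<beta> m u)"
proof -
  obtain K \<phi> z w where m: "m = (K, \<phi>, z, w)" by (cases m)
  have K: "K \<subseteq> fst \<alpha>" using assms unfolding m is_matching_def by simp
  let ?S = "SUP u. mcost d \<alpha> \<beta> m u"
  show ?thesis
  proof (rule antisym)
    have l: "mcost d \<alpha> \<beta> m u \<le> ?S" for u by (rule SUP_upper) simp
    have "d (snd \<alpha> k) (snd \<beta> (\<phi> k)) \<le> ?S" if "k \<in> K" for k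
      using l[of "Inl k"] that K by (auto simp: m mcost_simps)
    moreover have "d (snd \<alpha> i) (z i) \<le> ?S" if "i \<in> fst \<alpha> - K" for i
      using l[of "Inl i"] that by (auto simp: m mcost_simps)
    moreover have "d (w j) (snd \<beta> j) \<le> ?S" if "j \<in> fst \<beta> - \<phi> ` K" for j
      using l[of "Inr j"] that by (auto simp: m mcost_simps)
    ultimately show "icost d \<alpha> \<beta> m \<le> ?S"
      unfolding m icost_def prod.case by (intro sup_least SUP_least)
    show "?S \<le> icost d \<alpha> \<beta> m"
    proof (rule SUP_least)
      fix u show "mcost d \<alpha> \<beta> m u \<le> icost d \<alpha> \<beta> m"
      proof (cases u)
        case (Inl i)
        have "d (snd \<alpha> i) (snd \<beta> (\<phi> i)) \<le> icost d \<alpha> \<beta> m" if "i \<in> K"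
          unfolding m icost_def prod.case by (intro le_supI1 SUP_upper that)
        moreover have "d (snd \<alpha> i) (z i) \<le> icost d \<alpha> \<beta> m" if "i \<in> fst \<alpha> - K"
          unfolding m icost_def prod.case by (rule le_supI1, rule le_supI2) (intro SUP_upper that)
        ultimately show ?thesis using Inl by (simp add: m mcost_simps)
      next
        case (Inr j)
        have "d (w j) (snd \<beta> j) \<le> icost d \<alpha> \<beta> m" if "j \<in> fst \<beta> - \<phi> ` K"
          unfolding m icost_def prod.case by (intro le_supI2 SUP_upper that)
        then show ?thesis using Inr by (simp add: m mcost_simps)
      qed
    qed
  qed
qed

text \<open>The three sums of \<open>pcost\<close> run over disjoint pieces of nat + nat outside
  which \<open>mcost\<close> vanishes.\<close>

lemma pcost_eq_mcost:
  assumes "is_matching A \<alpha> \<beta> m"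
  shows "pcost d p \<alpha> \<beta> m = lp_norm p (mcost d \<alpha> \<beta> m)"
proof -
  obtain K \<phi> z w where m: "m = (K, \<phi>, z, w)" by (cases m)
  have K: "K \<subseteq> fst \<alpha>" using assms unfolding m is_matching_def by simp
  let ?f = "\<lambda>u. epowr (mcost d \<alpha> \<beta> m u) p"
  let ?X = "Inl ` K :: (nat + nat) set" and ?Y = "Inl ` (fst \<alpha> - K) :: (nat + nat) set"
    and ?Z = "Inr ` (fst \<beta> - \<phi> ` K) :: (nat + nat) set"
  have "infsum ?f UNIV = infsum ?f (?X \<union> ?Y \<union> ?Z)"
  proof (rule infsum_cong_neutral)
    fix u assume u: "u \<in> UNIV - (?X \<union> ?Y \<union> ?Z)"
    show "?f u = 0"
      by (cases u) (use u in \<open>auto simp: m mcost_simps epowr_0\<close>)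
  qed auto
  also have "\<dots> = infsum ?f (?X \<union> ?Y) + infsum ?f ?Z" by (intro infsum_Un_disjoint summable_on_ennreal_valued) auto
  also have "infsum ?f (?X \<union> ?Y) = infsum ?f ?X + infsum ?f ?Y" by (intro infsum_Un_disjoint summable_on_ennreal_valued) auto
  also have "infsum ?f ?X = (\<Sum>\<^sub>\<infinity>k\<in>K. epowr (d (snd \<alpha> k) (snd \<beta> (\<phi> k))) p)"
    by (subst infsum_reindex) (use K in \<open>auto simp: m mcost_simps o_def intro!: infsum_cong\<close>)
  also have "infsum ?f ?Y = (\<Sum>\<^sub>\<infinity>i\<in>fst \<alpha> - K. epowr (d (snd \<alpha> i) (z i)) p)"
    by (subst infsum_reindex) (auto simp: m mcost_simps o_def intro!: infsum_cong)
  also have "infsum ?f ?Z = (\<Sum>\<^sub>\<infinity>j\<in>fst \<beta> - \<phi> ` K. epowr (d (w j) (snd \<beta> j)) p)"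
    by (subst infsum_reindex) (auto simp: m mcost_simps o_def intro!: infsum_cong)
  finally show ?thesis unfolding pcost_def lp_norm_def m by simp
qed

section \<open>Identification of \<open>DN\<close> and of vanishing with the given notions\<close>

context diagram_norm
begin

lemma low_top_finite:
  assumes "\<alpha> \<in> DN" shows "N (low top \<alpha>) < top"
proof -
  obtain \<delta> :: real where \<delta>: "0 < \<delta>" "N (low (ennreal \<delta>) \<alpha>) < ennreal 1"
    using assms unfolding DN_def using zero_less_one by blast
  \<comment> \<open>Points infinitely far from \<open>A\<close> are left out, as in
    \<open>low top\<close>; hence the maximum of the remaining distances is finite.\<close>
  define F where "F = {i \<in> fst \<alpha>. ennreal \<delta> \<le> dA (snd \<alpha> i) \<and> dA (snd \<alpha> i) < top}"
  have "F \<subseteq> fst (upper d A (ennreal \<delta>) \<alpha>)" unfolding F_def by (auto simp: mem_upper_iff)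
  moreover have "finite (fst (upper d A (ennreal \<delta>) \<alpha>))" using assms \<delta>(1) unfolding DN_def by blast
  ultimately have F: "finite F" by (rule finite_subset)
  define h :: "nat + nat \<Rightarrow> ennreal" where "h = case_sum (\<lambda>i. if i \<in> F then dA (snd \<alpha> i) else 0) (\<lambda>_. 0)"
  define c where "c = Max (insert 0 ((\<lambda>i. dA (snd \<alpha> i)) ` F))"
  have c: "c < top" unfolding c_def using F by (subst Max_less_iff) (auto simp: F_def)
  have "N h \<le> of_nat (card (Inl ` F :: (nat + nat) set)) * c"
  proof (rule N_finite)
    fix u :: "nat + nat"
    show "h u \<le> c" if "u \<in> Inl ` F" using that F by (auto simp: h_def c_def intro!: Max_ge)
    show "h u = 0" if "u \<notin> Inl ` F" using that by (cases u) (auto simp: h_def)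
  qed (use F in simp)
  also have "\<dots> < top" using c by (simp add: ennreal_mult_less_top of_nat_less_top)
  finally have h: "N h < top" .
  have "N (low top \<alpha>) \<le> N (\<lambda>u. low (ennreal \<delta>) \<alpha> u + h u)"
  proof (rule N_mono)
    fix u show "low top \<alpha> u \<le> low (ennreal \<delta>) \<alpha> u + h u"
      by (cases u) (auto simp: low_simps h_def F_def not_less)
  qed
  also have "\<dots> \<le> N (low (ennreal \<delta>) \<alpha>) + N h" by (rule N_add)
  also have "\<dots> < top" using h less_trans[OF \<delta>(2) ennreal_less_top] by (simp add: ennreal_add_eq_top less_top)
  finally show ?thesis .
qed

text \<open>From right to left, small tails do all the work: outside a finite set of indices the
  finite distances to \<open>A\<close> have small norm. \<open>N_point\<close> then bounds each of
  them, giving finite upper parts, and a threshold below the finitely many exceptions gives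
  vanishing.\<close>

lemma DN_alt:
  assumes tail: "\<And>g (\<epsilon>::real). N g < top \<Longrightarrow> 0 < \<epsilon> \<Longrightarrow> \<exists>F. finite F \<and> N (\<lambda>i. if i \<in> F then 0 else g i) < ennreal \<epsilon>"
  shows "DN = {\<alpha> \<in> Dbar A. finite (fst (upper d A top \<alpha>)) \<and> W (lower d A top \<alpha>) zero_dgm < top}"
proof (intro set_eqI iffI)
  fix \<alpha> assume \<alpha>: "\<alpha> \<in> DN"
  then have D: "\<alpha> \<in> Dbar A" unfolding DN_def by simp
  have "W (lower d A top \<alpha>) zero_dgm \<le> N (low top \<alpha>) + N (low top \<alpha>)" by (rule W_le_N_low[OF D])
  also have "\<dots> < top" using low_top_finite[OF \<alpha>] by simp
  finally have "W (lower d A top \<alpha>) zero_dgm < top" .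
  moreover have "finite (fst (upper d A (ennreal 1) \<alpha>))" using \<alpha> zero_less_one unfolding DN_def by blast
  then have "finite (fst (upper d A top \<alpha>))"
    by (rule rev_finite_subset) (auto simp: mem_upper_iff top_unique)
  ultimately show "\<alpha> \<in> {\<alpha> \<in> Dbar A. finite (fst (upper d A top \<alpha>)) \<and> W (lower d A top \<alpha>) zero_dgm < top}"
    using D by simp
next
  fix \<alpha> assume "\<alpha> \<in> {\<alpha> \<in> Dbar A. finite (fst (upper d A top \<alpha>)) \<and> W (lower d A top \<alpha>) zero_dgm < top}"
  then have D: "\<alpha> \<in> Dbar A" and fin: "finite (fst (upper d A top \<alpha>))"
    and W: "W (lower d A top \<alpha>) zero_dgm < top" by auto
  have N: "N (low top \<alpha>) < top" using N_low_le_W[OF D] W by (rule le_less_trans)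
  have out: "snd \<alpha> i \<notin> A" if "i \<in> fst \<alpha>" for i using D that unfolding Dbar_def by auto
  show "\<alpha> \<in> DN" unfolding DN_def
  proof (intro CollectI conjI allI impI D)
    fix \<delta> :: real assume \<delta>: "0 < \<delta>"
    obtain F where F: "finite F" "N (\<lambda>i. if i \<in> F then 0 else low top \<alpha> i) < ennreal \<delta>"
      using tail[OF N \<delta>] by blast
    have "i \<in> fst (upper d A top \<alpha>) \<union> Inl -` F" if i: "i \<in> fst (upper d A (ennreal \<delta>) \<alpha>)" for i
    proof (rule ccontr)
      assume "\<not> ?thesis"
      then have "low top \<alpha> (Inl i) = dA (snd \<alpha> i)" "Inl i \<notin> F"
        using i by (auto simp: mem_upper_iff low_simps not_le top_unique less_top)
      then have "dA (snd \<alpha> i) < ennreal \<delta>"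
        using le_less_trans[OF N_point[of "\<lambda>i. if i \<in> F then 0 else low top \<alpha> i" "Inl i"] F(2)] by simp
      then show False using i by (auto simp: mem_upper_iff)
    qed
    moreover have "finite (fst (upper d A top \<alpha>) \<union> Inl -` F)"
      using fin finite_vimageI[OF F(1), of Inl] by simp
    ultimately show "finite (fst (upper d A (ennreal \<delta>) \<alpha>))" by (meson finite_subset subsetI)
  next
    fix \<epsilon> :: real assume \<epsilon>: "0 < \<epsilon>"
    obtain F where F: "finite F" "N (\<lambda>i. if i \<in> F then 0 else low top \<alpha> i) < ennreal \<epsilon>"
      using tail[OF N \<epsilon>] by blast
    have fin: "finite (Inl -` F \<inter> fst \<alpha>)" using finite_vimageI[OF F(1), of Inl] by simp
    define c where "c = Min (insert 1 ((\<lambda>i. dA (snd \<alpha> i)) ` (Inl -` F \<inter> fst \<alpha>)))"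
    have "0 < c" unfolding c_def using fin dA_pos out by (subst Min_gr_iff) auto
    then obtain r :: real where r: "0 < r" "ennreal r \<le> c" by (rule ennreal_pos_real_below)
    have "c \<le> dA (snd \<alpha> i)" if "i \<in> fst \<alpha>" "Inl i \<in> F" for i
      unfolding c_def using fin that by (intro Min_le) auto
    then have far: "\<not> dA (snd \<alpha> i) < ennreal r" if "i \<in> fst \<alpha>" "Inl i \<in> F" for i
      using that r(2) by (meson not_less order_trans)
    have "N (low (ennreal r) \<alpha>) \<le> N (\<lambda>i. if i \<in> F then 0 else low top \<alpha> i)"
    proof (rule N_mono)
      fix u show "low (ennreal r) \<alpha> u \<le> (if u \<in> F then 0 else low top \<alpha> u)"
        using far by (cases u) (auto simp: low_simps less_top[symmetric])
    qed
    then have "N (low (ennreal r) \<alpha>) < ennreal \<epsilon>" using F(2) by (rule le_less_trans)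
    then show "\<exists>\<delta>::real. 0 < \<delta> \<and> N (low (ennreal \<delta>) \<alpha>) < ennreal \<epsilon>" using r(1) by blast
  qed
qed

lemma N_vanishing_iff:
  assumes S: "S \<subseteq> Dbar A"
  shows "N_vanishing S \<longleftrightarrow> (\<forall>\<epsilon>::real. 0 < \<epsilon> \<longrightarrow> (\<exists>\<delta>::real. 0 < \<delta> \<and>
    (\<forall>\<alpha>\<in>S. W (lower d A (ennreal \<delta>) \<alpha>) zero_dgm < ennreal \<epsilon>)))" (is "_ \<longleftrightarrow> ?R")
proof
  assume V: "N_vanishing S"
  show ?R
  proof (intro allI impI)
    fix \<epsilon> :: real assume "0 < \<epsilon>"
    then have "0 < \<epsilon>/2" by simp
    then obtain \<delta> :: real where \<delta>: "0 < \<delta>" "\<And>\<alpha>. \<alpha> \<in> S \<Longrightarrow> N (low (ennreal \<delta>) \<alpha>) < ennreal (\<epsilon>/2)"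
      using V unfolding N_vanishing_def by blast
    have "W (lower d A (ennreal \<delta>) \<alpha>) zero_dgm < ennreal \<epsilon>" if "\<alpha> \<in> S" for \<alpha>
    proof -
      have "W (lower d A (ennreal \<delta>) \<alpha>) zero_dgm \<le> N (low (ennreal \<delta>) \<alpha>) + N (low (ennreal \<delta>) \<alpha>)"
        using S that by (intro W_le_N_low) auto
      also have "\<dots> < ennreal (\<epsilon>/2 + \<epsilon>/2)" using \<delta>(2)[OF that] by (intro ennreal_add_less)
      finally show ?thesis by simp
    qed
    then show "\<exists>\<delta>::real. 0 < \<delta> \<and> (\<forall>\<alpha>\<in>S. W (lower d A (ennreal \<delta>) \<alpha>) zero_dgm < ennreal \<epsilon>)"
      using \<delta>(1) by blast
  qed
next
  assume ?R
  then show "N_vanishing S" unfolding N_vanishing_def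
    using N_low_le_W S by (meson le_less_trans subsetD)
qed

end

theorem theorem7p34:
  fixes d :: "'a \<Rightarrow> 'a \<Rightarrow> ennreal" and A :: "'a set"
  assumes "metric_pair d A"
  shows "(\<forall>S. S \<subseteq> Dinf d A \<longrightarrow>
            (rel_compact_in (ball_topology (Dinf d A) (Winf d A)) S \<longleftrightarrow>
             unif_upper_finite d A S \<and> upper_rel_compact d A S))
       \<and> (\<forall>p::real. \<forall>S. 1 \<le> p \<longrightarrow> S \<subseteq> Dp d A p \<longrightarrow>
            (rel_compact_in (ball_topology (Dp d A p) (Wp d A p)) S \<longleftrightarrow>
             unif_upper_finite d A S \<and> upper_rel_compact d A S \<and> unif_p_vanishing d A p S))"
proof (intro conjI allI impI)
  fix S assume S: "S \<subseteq> Dinf d A"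
  interpret diagram_norm "\<lambda>g. SUP i. g i" d A
    by (intro diagram_norm.intro sup_norm_cost_norm diagram_norm_axioms.intro assms)
  \<comment> \<open>All entries of \<open>low\<close> at threshold \<delta> are at most \<delta>, so
    for the sup norm vanishing holds for every diagram, with \<delta> independent of it.\<close>
  have low: "(SUP i. low (ennreal \<delta>) \<alpha> i) < ennreal \<epsilon>" if "0 < \<epsilon>" "\<delta> = \<epsilon>/2" for \<alpha> and \<epsilon> \<delta> :: real
  proof -
    have "(SUP i. low (ennreal \<delta>) \<alpha> i) \<le> ennreal \<delta>"
      by (rule SUP_least) (auto simp: low_def split: sum.splits)
    also have "\<dots> < ennreal \<epsilon>" using that by (simp add: ennreal_less_iff)
    finally show ?thesis .
  qed
  have "W = Winf d A"
    unfolding W_def Winf_def by (intro ext INF_cong refl) (simp add: icost_eq_mcost)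
  moreover have "DN = Dinf d A"
  proof -
    have "\<exists>\<delta>::real. 0 < \<delta> \<and> (SUP i. low (ennreal \<delta>) \<alpha> i) < ennreal \<epsilon>" if "0 < \<epsilon>" for \<alpha> and \<epsilon> :: real
      using low[OF that refl] that by (intro exI[of _ "\<epsilon>/2"]) simp
    then show ?thesis unfolding DN_def Dinf_def by auto
  qed
  moreover have "N_vanishing S" unfolding N_vanishing_def
  proof (intro allI impI)
    fix \<epsilon> :: real assume \<epsilon>: "0 < \<epsilon>"
    show "\<exists>\<delta>::real. 0 < \<delta> \<and> (\<forall>\<alpha>\<in>S. (SUP i. low (ennreal \<delta>) \<alpha> i) < ennreal \<epsilon>)"
      using low[OF \<epsilon> refl] \<epsilon> by (intro exI[of _ "\<epsilon>/2"]) simp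
  qed
  ultimately show "rel_compact_in (ball_topology (Dinf d A) (Winf d A)) S \<longleftrightarrow>
      unif_upper_finite d A S \<and> upper_rel_compact d A S"
    using rel_compact_iff[of S] S by simp
next
  fix p :: real and S assume p: "1 \<le> p" and S: "S \<subseteq> Dp d A p"
  interpret diagram_norm "lp_norm p" d A
    by (intro diagram_norm.intro lp_norm_cost_norm diagram_norm_axioms.intro assms p)
  have W: "W = Wp d A p"
    unfolding W_def Wp_def by (intro ext INF_cong refl) (simp add: pcost_eq_mcost)
  have D: "DN = Dp d A p"
    unfolding Dp_def infinity_ennreal_def W[symmetric]
    by (rule DN_alt) (metis lp_norm_tail[OF p])
  have "S \<subseteq> Dbar A" using S unfolding Dp_def by auto
  then have "N_vanishing S \<longleftrightarrow> unif_p_vanishing d A p S"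
    unfolding N_vanishing_iff unif_p_vanishing_def W by (simp add: N_vanishing_iff W)
  then show "rel_compact_in (ball_topology (Dp d A p) (Wp d A p)) S \<longleftrightarrow>
      unif_upper_finite d A S \<and> upper_rel_compact d A S \<and> unif_p_vanishing d A p S"
    using rel_compact_iff[of S] S unfolding D W by simp
qed

end
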